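(* Let $K\subset\mathbb{C}$ be a compact non-polar set and let $\mu\in\mathcal{M}^+(K)$ be such that $\operatorname{supp}\mu=K$ and $(K,\mu)$ has the Bernstein Markov property. Let $P\subset\mathbb{C}$ be a compact set with $K\cap P=\emptyset$, and suppose that at least one of the following holds: (a) $S_K=K$; (b) $\hat K\cap P=\emptyset$. Then for every weight $w\in\mathcal{W}(P)$ the triple $[K,\mu,w]$ has the weighted Bernstein Markov property, and thus $(K,\mu,P)$ has the rational Bernstein Markov property.
   Context: $\mathcal{P}^k$ is the space of complex polynomials in one variable of degree at most $k$, and $\mathcal{P}=\bigcup_k\mathcal{P}^k$. For a compact set $K\subset\mathbb{C}$, $\mathcal{M}^+(K)$ is the cone of positive finite Borel measures $\mu$ with $\operatorname{supp}\mu\subseteq K$. $\|g\|_K=\sup_{z\in K}|g(z)|$ and $\|g\|_{L^2_\mu}=(\int|g|^2\,d\mu)^{1/2}$. Convention: in all ratios below only functions not vanishing identically on $K$ are considered, and a ratio is $+\infty$ if its denominator is $0$ and its numerator is positive. Bernstein Markov property of $(K,\mu)$: for every sequence $\{p_k\}$ with $p_k\in\mathcal{P}^k$, $\limsup_k\left(\|p_k\|_K/\|p_k\|_{L^2_\mu}\right)^{1/k}\le 1$. Weighted Bernstein Markov property of $[K,\mu,w]$, for an upper semicontinuous $w:K\to[0,+\infty[$: for every sequence $\{p_k\}$ with $p_k\in\mathcal{P}^k$, $\limsup_k\left(\|p_kw^k\|_K/\|p_kw^k\|_{L^2_\mu}\right)^{1/k}\le 1$. Rational Bernstein Markov property of $(K,\mu,P)$,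 for disjoint compact sets $K,P$: $\limsup_k\left(\|r_k\|_K/\|r_k\|_{L^2_\mu}\right)^{1/k}\le 1$ for every sequence $\{r_k\}$ of the form $r_k=p_k/q_k$ with $p_k,q_k\in\mathcal{P}^k$ and $\{z\in\mathbb{C}:q_k(z)=0\}\subseteq P$ for all $k\in\mathbb{N}$. For a finite positive Borel measure $\sigma$ with compact support, $U^\sigma(z):=-\int\log|z-\zeta|\,d\sigma(\zeta)$ (with $U^0\equiv 0$), and $\mathcal{W}(P):=\{e^{U^\sigma}:\sigma\in\mathcal{M}^+(P),\ 0\le\sigma(P)<\infty\}$ (weights restricted to $K$). The polynomial hull of $K$ is $\hat K:=\{z\in\mathbb{C}:|p(z)|\le\|p\|_K\ \forall p\in\mathcal{P}\}$. $S_K$ is the Shilov boundary of $K$ with respect to the uniform algebra of all uniform limits on $K$ of polynomials, i.e. the smallest closed subset $B$ of $K$ such that $\max_K|f|=\max_B|f|$ for every $f$ in this algebra. *)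

theory Defs
  imports "HOL-Analysis.Analysis" "HOL-Computational_Algebra.Polynomial"
begin

definition measure_support :: "complex measure \<Rightarrow> complex set" where
  "measure_support \<mu> = {z. \<forall>U. open U \<and> z \<in> U \<longrightarrow> emeasure \<mu> U > 0}"

definition positive_measures :: "complex set \<Rightarrow> complex measure set" where
  "positive_measures K =
     {\<mu>. sets \<mu> = sets borel \<and> finite_measure \<mu> \<and> measure_support \<mu> \<subseteq> K}"

text \<open>The kernel \<open>log (1 / |z - \<zeta>|)\<close>, with its value \<open>+\<infinity>\<close> on the diagonal
  (where \<^term>\<open>ln 0\<close> would give \<open>0\<close>).\<close>

definition log_kernel :: "complex \<Rightarrow> complex \<Rightarrow> ereal" where
  "log_kernel z \<zeta> = (if z = \<zeta> then \<infinity> else ereal (- ln (cmod (z - \<zeta>))))"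

text \<open>The logarithmic energy \<open>\<integral>\<integral> log (1 / |z - \<zeta>|) d\<nu>(\<zeta>) d\<nu>(z)\<close>, as the integral of the
  positive part minus that of the negative part (\<^const>\<open>e2ennreal\<close> truncates at \<open>0\<close>).
  The latter is finite when \<open>\<nu>\<close> is finite with compact support.\<close>

definition log_energy :: "complex measure \<Rightarrow> ereal" where
  "log_energy \<nu> =
     enn2ereal (\<integral>\<^sup>+ z. (\<integral>\<^sup>+ \<zeta>. e2ennreal (log_kernel z \<zeta>) \<partial>\<nu>) \<partial>\<nu>)
     - enn2ereal (\<integral>\<^sup>+ z. (\<integral>\<^sup>+ \<zeta>. e2ennreal (- log_kernel z \<zeta>) \<partial>\<nu>) \<partial>\<nu>)"

definition polar :: "complex set \<Rightarrow> bool" where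
  "polar E \<longleftrightarrow>
     (\<forall>\<nu>\<in>positive_measures E. compact (measure_support \<nu>) \<and> emeasure \<nu> UNIV \<noteq> 0
        \<longrightarrow> log_energy \<nu> = \<infinity>)"

text \<open>The following suprema are taken over nonempty \<open>K\<close> and for \<open>g\<close> bounded on \<open>K\<close>.\<close>

definition sup_norm :: "complex set \<Rightarrow> (complex \<Rightarrow> complex) \<Rightarrow> real" where
  "sup_norm K g = (SUP z\<in>K. cmod (g z))"

text \<open>For \<open>\<mu>\<close> supported in \<open>K\<close> the integral over \<open>K\<close> is the full integral; writing it over \<open>K\<close>
  makes the values of \<open>g\<close> outside \<open>K\<close> irrelevant.\<close>

definition L2_norm_on :: "complex set \<Rightarrow> complex measure \<Rightarrow> (complex \<Rightarrow> complex) \<Rightarrow> real" where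
  "L2_norm_on K \<mu> g = sqrt (LINT z:K|\<mu>. (cmod (g z))\<^sup>2)"

text \<open>\<open>(a / b)\<^bsup>1/k\<^esup>\<close>, with the convention \<open>a / 0 = +\<infinity>\<close> for \<open>a > 0\<close>.\<close>

definition ratio_root :: "nat \<Rightarrow> real \<Rightarrow> real \<Rightarrow> ereal" where
  "ratio_root k a b = (if b = 0 \<and> a > 0 then \<infinity> else ereal (root k (a / b)))"

definition limsup_norm_ratio_le_1 ::
    "complex set \<Rightarrow> complex measure \<Rightarrow> (nat \<Rightarrow> complex \<Rightarrow> complex) \<Rightarrow> bool" where
  "limsup_norm_ratio_le_1 K \<mu> g \<longleftrightarrow>
     limsup (\<lambda>k. ratio_root k (sup_norm K (g k)) (L2_norm_on K \<mu> (g k))) \<le> 1"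

definition nonvanishing_seq :: "complex set \<Rightarrow> (nat \<Rightarrow> complex \<Rightarrow> complex) \<Rightarrow> bool" where
  "nonvanishing_seq K g \<longleftrightarrow> (\<forall>k. \<exists>z\<in>K. g k z \<noteq> 0)"

definition Bernstein_Markov :: "complex set \<Rightarrow> complex measure \<Rightarrow> bool" where
  "Bernstein_Markov K \<mu> \<longleftrightarrow>
     (\<forall>p :: nat \<Rightarrow> complex poly.
        (\<forall>k. degree (p k) \<le> k) \<and> nonvanishing_seq K (\<lambda>k. poly (p k))
        \<longrightarrow> limsup_norm_ratio_le_1 K \<mu> (\<lambda>k. poly (p k)))"

text \<open>Upper semicontinuous functions \<open>K \<rightarrow> [0, \<infinity>)\<close>; values outside \<open>K\<close> are irrelevant.\<close>

definition weight_on :: "complex set \<Rightarrow> (complex \<Rightarrow> real) \<Rightarrow> bool" where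
  "weight_on K w \<longleftrightarrow>
     (\<forall>z\<in>K. 0 \<le> w z) \<and> (\<forall>c. openin (top_of_set K) {z\<in>K. w z < c})"

definition weighted_Bernstein_Markov ::
    "complex set \<Rightarrow> complex measure \<Rightarrow> (complex \<Rightarrow> real) \<Rightarrow> bool" where
  "weighted_Bernstein_Markov K \<mu> w \<longleftrightarrow>
     weight_on K w \<and>
     (\<forall>p :: nat \<Rightarrow> complex poly.
        (\<forall>k. degree (p k) \<le> k) \<and>
        nonvanishing_seq K (\<lambda>k z. poly (p k) z * of_real (w z ^ k))
        \<longrightarrow> limsup_norm_ratio_le_1 K \<mu> (\<lambda>k z. poly (p k) z * of_real (w z ^ k)))"

definition rational_Bernstein_Markov ::
    "complex set \<Rightarrow> complex measure \<Rightarrow> complex set \<Rightarrow> bool" where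
  "rational_Bernstein_Markov K \<mu> P \<longleftrightarrow>
     (\<forall>p q :: nat \<Rightarrow> complex poly.
        (\<forall>k. degree (p k) \<le> k \<and> degree (q k) \<le> k \<and> {z. poly (q k) z = 0} \<subseteq> P) \<and>
        nonvanishing_seq K (\<lambda>k z. poly (p k) z / poly (q k) z)
        \<longrightarrow> limsup_norm_ratio_le_1 K \<mu> (\<lambda>k z. poly (p k) z / poly (q k) z))"

text \<open>Only meaningful for \<open>z\<close> outside the support of \<open>\<sigma>\<close>, where \<open>log |z - \<zeta>|\<close> is bounded on
  the (compact) support; at other points the true value may be \<open>+\<infinity>\<close>.\<close>

definition log_potential :: "complex measure \<Rightarrow> complex \<Rightarrow> real" where
  "log_potential \<sigma> z = - (LINT \<zeta>|\<sigma>. ln (cmod (z - \<zeta>)))"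

text \<open>To be used only on sets disjoint from \<open>P\<close>.\<close>

definition potential_weights :: "complex set \<Rightarrow> (complex \<Rightarrow> real) set" where
  "potential_weights P = {\<lambda>z. exp (log_potential \<sigma> z) | \<sigma>. \<sigma> \<in> positive_measures P}"

definition polynomial_hull :: "complex set \<Rightarrow> complex set" where
  "polynomial_hull K = {z. \<forall>p :: complex poly. cmod (poly p z) \<le> sup_norm K (poly p)}"

definition poly_uniform_limits :: "complex set \<Rightarrow> (complex \<Rightarrow> complex) set" where
  "poly_uniform_limits K =
     {f. \<exists>p :: nat \<Rightarrow> complex poly. uniform_limit K (\<lambda>n. poly (p n)) f sequentially}"

text \<open>Nonemptiness is implicit in the existence of the maximum over \<open>B\<close>.\<close>

definition closed_boundary :: "complex set \<Rightarrow> complex set \<Rightarrow> bool" where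
  "closed_boundary K B \<longleftrightarrow>
     closed B \<and> B \<subseteq> K \<and> B \<noteq> {} \<and> (\<forall>f\<in>poly_uniform_limits K. sup_norm K f = sup_norm B f)"

definition is_shilov_boundary :: "complex set \<Rightarrow> complex set \<Rightarrow> bool" where
  "is_shilov_boundary K S \<longleftrightarrow>
     closed_boundary K S \<and> (\<forall>B. closed_boundary K B \<longrightarrow> S \<subseteq> B)"

end

theory Submission
  imports Defs "HOL-Complex_Analysis.Conformal_Mappings"
    "HOL-Computational_Algebra.Fundamental_Theorem_Algebra"
begin

text \<open>
The Bernstein Markov property is an estimate up to factors \<open>t\<^sup>k\<close> with \<open>t > 1\<close> arbitrary, so replacing
polynomials of degree \<open>k\<close> by polynomials of degree at most \<open>m k\<close>, with \<open>m\<close> fixed, costs nothing.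
Hence it suffices to turn \<open>p / q\<close>, with the zeros of \<open>q\<close> in \<open>P\<close>, into polynomials by multiplying with
polynomials of degree \<open>O(k)\<close> and losing only factors \<open>t\<^sup>k\<close>. To bound \<open>|p / q|\<close> at one point \<open>z1\<close> of \<open>K\<close>
by the \<open>L\<^sup>2\<close> norm, no uniform approximation of \<open>1 / |q|\<close> is required: a polynomial \<open>G\<close> with
\<open>G(z1) = 1\<close> and \<open>|G| \<le> t\<^sup>k |q(z1)| / |q|\<close> on \<open>K\<close> is enough (\<open>rational_norm_comparison\<close>). Such a \<open>G\<close> is a
product over the zeros of \<open>q\<close>, so the matter reduces to a single pole \<open>\<zeta> \<in> P\<close>, with a degree
that is bounded uniformly in \<open>\<zeta>\<close> and \<open>z1\<close> (\<open>poles_absorbed\<close>).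

If \<open>\<zeta>\<close> is not in the polynomial hull, \<open>1 / (z - \<zeta>)\<close> is a uniform limit of polynomials on \<open>K\<close>, and this
gives the factor (\<open>poles_absorbed_off_hull\<close>). If \<open>K\<close> is its own Shilov boundary, \<open>\<zeta>\<close> may lie
in a hole of \<open>K\<close>, where this fails. But then every point of \<open>K\<close> is in the closure of the unbounded
component of the complement (\<open>shilov_imp_outer_boundary\<close>), and at such a point polynomials peak
(\<open>peaking_polynomial\<close>): there are polynomials equal to \<open>1\<close> at the point, hardly larger than \<open>1\<close> on
\<open>K\<close> and as small as desired off a given neighbourhood. Since \<open>|z - \<zeta>|\<close> is nearly constant on a
small neighbourhood, a peaking polynomial is the required factor
(\<open>poles_absorbed_outer_boundary\<close>). The peaking polynomials come from a square root of
\<open>(z - b) / (z - a)\<close>, continued along a path from \<open>a\<close> to \<open>b\<close> in the unbounded component, by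
means of a Koebe type estimate (\<open>bounded_peaking_limit\<close>) and Bishop's averaging trick.

Finally a weight \<open>w = exp U\<^sup>\<sigma>\<close> is reduced to the rational case: discretising \<open>\<sigma>\<close> and rounding the
masses gives polynomials \<open>q\<close> of degree \<open>O(k)\<close>, with zeros in \<open>P\<close>, such that \<open>w\<^sup>k |q|\<close> lies between
\<open>t\<^sup>-\<^sup>k\<close> and \<open>t\<^sup>k\<close> on \<open>K\<close> (\<open>potential_weight_approx\<close>).\<close>

section \<open>The uniform closure of the polynomials on a compact set\<close>

lemma poly_uniform_limits_iff:
  "f \<in> poly_uniform_limits K \<longleftrightarrow> (\<forall>e>0. \<exists>p. \<forall>z\<in>K. cmod (poly p z - f z) < e)"
proof
  assume "f \<in> poly_uniform_limits K"
  then obtain p where "uniform_limit K (\<lambda>n. poly (p n)) f sequentially"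
    by (auto simp: poly_uniform_limits_def)
  then show "\<forall>e>0. \<exists>p. \<forall>z\<in>K. cmod (poly p z - f z) < e"
    unfolding uniform_limit_sequentially_iff dist_norm by blast
next
  assume *: "\<forall>e>0. \<exists>p. \<forall>z\<in>K. cmod (poly p z - f z) < e"
  have "\<forall>n. \<exists>p. \<forall>z\<in>K. cmod (poly p z - f z) < inverse (real (Suc n))"
    using * by simp
  then obtain p where p: "\<And>n z. z \<in> K \<Longrightarrow> cmod (poly (p n) z - f z) < inverse (real (Suc n))"
    by metis
  have "uniform_limit K (\<lambda>n. poly (p n)) f sequentially"
    unfolding uniform_limit_sequentially_iff dist_norm
  proof (intro allI impI)
    fix e :: real assume "e > 0"
    then obtain N where N: "inverse (real (Suc N)) < e"
      using reals_Archimedean by blast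
    show "\<exists>N. \<forall>n\<ge>N. \<forall>x\<in>K. cmod (poly (p n) x - f x) < e"
    proof (intro exI allI impI ballI)
      fix n x assume "n \<ge> N" "x \<in> K"
      then have "inverse (real (Suc n)) \<le> inverse (real (Suc N))"
        by (intro le_imp_inverse_le) auto
      with p[OF \<open>x \<in> K\<close>, of n] N show "cmod (poly (p n) x - f x) < e" by linarith
    qed
  qed
  then show "f \<in> poly_uniform_limits K"
    by (auto simp: poly_uniform_limits_def)
qed

lemma poly_uniform_limits_closed:
  assumes "\<And>e. e > 0 \<Longrightarrow> \<exists>g\<in>poly_uniform_limits K. \<forall>z\<in>K. cmod (g z - f z) < e"
  shows "f \<in> poly_uniform_limits K"
  unfolding poly_uniform_limits_iff
proof (intro allI impI)
  fix e :: real assume "e > 0"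
  then obtain g where g: "g \<in> poly_uniform_limits K" "\<And>z. z \<in> K \<Longrightarrow> cmod (g z - f z) < e/2"
    using assms[of "e/2"] by auto
  obtain p where p: "\<And>z. z \<in> K \<Longrightarrow> cmod (poly p z - g z) < e/2"
    using g(1) \<open>e > 0\<close> unfolding poly_uniform_limits_iff by (meson half_gt_zero)
  have "cmod (poly p z - f z) < e" if "z \<in> K" for z
    using norm_triangle_lt[of "poly p z - g z" "g z - f z" e] p[OF that] g(2)[OF that] by simp
  then show "\<exists>p. \<forall>z\<in>K. cmod (poly p z - f z) < e" by blast
qed

lemma poly_uniform_limits_cong:
  assumes "f \<in> poly_uniform_limits K" "\<And>z. z \<in> K \<Longrightarrow> f z = g z"
  shows "g \<in> poly_uniform_limits K"
  using assms unfolding poly_uniform_limits_iff by simp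

lemma poly_uniform_limits_poly [simp]: "poly p \<in> poly_uniform_limits K"
  unfolding poly_uniform_limits_iff by (intro allI impI exI[of _ p]) simp

lemma poly_uniform_limits_const [simp]: "(\<lambda>z. c) \<in> poly_uniform_limits K"
  by (rule poly_uniform_limits_cong[OF poly_uniform_limits_poly[of "[:c:]"]]) simp

lemma poly_uniform_limits_linear [simp]: "(\<lambda>z. z - c) \<in> poly_uniform_limits K"
  by (rule poly_uniform_limits_cong[OF poly_uniform_limits_poly[of "[:-c, 1:]"]]) simp

lemma poly_uniform_limits_add:
  assumes "f \<in> poly_uniform_limits K" "g \<in> poly_uniform_limits K"
  shows "(\<lambda>z. f z + g z) \<in> poly_uniform_limits K"
proof -
  from assms obtain p q where "uniform_limit K (\<lambda>n. poly (p n)) f sequentially"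
      "uniform_limit K (\<lambda>n. poly (q n)) g sequentially"
    by (auto simp: poly_uniform_limits_def)
  moreover have "poly (p n + q n) = (\<lambda>z. poly (p n) z + poly (q n) z)" for n by auto
  ultimately have "uniform_limit K (\<lambda>n. poly (p n + q n)) (\<lambda>z. f z + g z) sequentially"
    by (simp add: uniform_limit_add)
  then show ?thesis
    unfolding poly_uniform_limits_def mem_Collect_eq by (rule exI[of _ "\<lambda>n. p n + q n"])
qed

lemma poly_uniform_limits_continuous:
  assumes "f \<in> poly_uniform_limits K"
  shows "continuous_on K f"
proof -
  from assms obtain p where "uniform_limit K (\<lambda>n. poly (p n)) f sequentially"
    by (auto simp: poly_uniform_limits_def)
  moreover have "continuous_on K (\<lambda>z. poly (p n) z)" for n by (intro continuous_intros)
  ultimately show ?thesis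
    by (intro uniform_limit_theorem[of _ "\<lambda>n. poly (p n)" sequentially]) auto
qed

lemma poly_uniform_limits_bounded:
  assumes "compact K" "f \<in> poly_uniform_limits K"
  shows "bounded (f ` K)"
  using assms compact_continuous_image compact_imp_bounded poly_uniform_limits_continuous by blast

lemma poly_uniform_limits_mult:
  assumes "compact K" "f \<in> poly_uniform_limits K" "g \<in> poly_uniform_limits K"
  shows "(\<lambda>z. f z * g z) \<in> poly_uniform_limits K"
proof -
  from assms obtain p q where "uniform_limit K (\<lambda>n. poly (p n)) f sequentially"
      "uniform_limit K (\<lambda>n. poly (q n)) g sequentially"
    by (auto simp: poly_uniform_limits_def)
  moreover have "poly (p n * q n) = (\<lambda>z. poly (p n) z * poly (q n) z)" for n by auto
  ultimately have "uniform_limit K (\<lambda>n. poly (p n * q n)) (\<lambda>z. f z * g z) sequentially"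
    using assms by (simp add: uniform_lim_mult poly_uniform_limits_bounded)
  then show ?thesis
    unfolding poly_uniform_limits_def mem_Collect_eq by (rule exI[of _ "\<lambda>n. p n * q n"])
qed

lemma poly_uniform_limits_minus:
  assumes "compact K" "f \<in> poly_uniform_limits K" "g \<in> poly_uniform_limits K"
  shows "(\<lambda>z. f z - g z) \<in> poly_uniform_limits K"
  using poly_uniform_limits_add[OF assms(2) poly_uniform_limits_mult[OF assms(1)
        poly_uniform_limits_const[of "-1"] assms(3)]] by simp

lemma poly_uniform_limits_power:
  assumes "compact K" "f \<in> poly_uniform_limits K"
  shows "(\<lambda>z. f z ^ n) \<in> poly_uniform_limits K"
  by (induction n) (auto intro: poly_uniform_limits_mult assms)

lemma poly_uniform_limits_sum:
  assumes "\<And>i. i < n \<Longrightarrow> f i \<in> poly_uniform_limits K"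
  shows "(\<lambda>z. \<Sum>i<(n::nat). f i z) \<in> poly_uniform_limits K"
  using assms by (induction n) (auto intro: poly_uniform_limits_add)

text \<open>The power series of \<open>h\<close> converges uniformly on the disc of radius \<open>1/2\<close>, and its partial sums
evaluated at \<open>x\<close> stay in the algebra. Any radius below \<open>1\<close> would do. This is the holomorphic
functional calculus in the only form needed here; it yields inverses and square roots of
elements close to \<open>1\<close>.\<close>

lemma poly_uniform_limits_holomorphic_compose:
  assumes "compact K" "x \<in> poly_uniform_limits K" "\<And>z. z \<in> K \<Longrightarrow> cmod (x z) \<le> 1/2"
    and h: "h holomorphic_on ball 0 1"
  shows "(\<lambda>z. h (x z)) \<in> poly_uniform_limits K"
proof -
  define a where "a = (\<lambda>n. (deriv ^^ n) h 0 / fact n)"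
  have sums: "(\<lambda>n. a n * w ^ n) sums h w" if "cmod w < 1" for w
    using holomorphic_power_series[OF h, of w] that by (simp add: a_def)
  have "ereal (cmod (3/4)) \<le> conv_radius a"
    using sums[of "3/4"] by (intro conv_radius_geI) (auto simp: sums_iff)
  then have "ereal (1/2) < conv_radius a"
    by (rule less_le_trans[rotated]) simp
  from powser_uniform_limit[OF this, of 0]
  have lim: "uniform_limit (cball 0 (1/2)) (\<lambda>n w. \<Sum>i<n. a i * w ^ i) (\<lambda>w. \<Sum>i. a i * w ^ i) sequentially"
    by simp
  show ?thesis
  proof (rule poly_uniform_limits_closed)
    fix e :: real assume "e > 0"
    with lim obtain N where N: "\<And>w. w \<in> cball 0 (1/2) \<Longrightarrow> dist (\<Sum>i<N. a i * w ^ i) (\<Sum>i. a i * w ^ i) < e"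
      unfolding uniform_limit_sequentially_iff by blast
    have "cmod ((\<Sum>i<N. a i * x z ^ i) - h (x z)) < e" if "z \<in> K" for z
      using N[of "x z"] assms(3)[OF that] sums[of "x z"] by (simp add: dist_norm sums_iff)
    moreover have "(\<lambda>z. \<Sum>i<N. a i * x z ^ i) \<in> poly_uniform_limits K"
      by (intro poly_uniform_limits_sum poly_uniform_limits_mult poly_uniform_limits_power
          poly_uniform_limits_const assms)
    ultimately show "\<exists>g\<in>poly_uniform_limits K. \<forall>z\<in>K. cmod (g z - h (x z)) < e"
      by (intro bexI[of _ "\<lambda>z. \<Sum>i<N. a i * x z ^ i"]) auto
  qed
qed

text \<open>With \<open>x = (g - f) / f\<close>, which is at most \<open>1/2\<close> in modulus, \<open>1 / g\<close> is \<open>(1 / f) \<cdot> 1 / (1 + x)\<close>, and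
the second factor is a convergent Neumann series. The lemma lets invertibility in the algebra
propagate along connected families.\<close>

lemma poly_uniform_limits_inverse_perturb:
  assumes "compact K" "f \<in> poly_uniform_limits K" "g \<in> poly_uniform_limits K"
    and inv: "(\<lambda>z. 1 / f z) \<in> poly_uniform_limits K"
    and nz: "\<And>z. z \<in> K \<Longrightarrow> f z \<noteq> 0"
    and le: "\<And>z. z \<in> K \<Longrightarrow> cmod (g z - f z) \<le> cmod (f z) / 2"
  shows "(\<lambda>z. 1 / g z) \<in> poly_uniform_limits K"
proof -
  define x where "x = (\<lambda>z. (g z - f z) * (1 / f z))"
  have "x \<in> poly_uniform_limits K"
    unfolding x_def by (intro poly_uniform_limits_mult poly_uniform_limits_minus assms)
  moreover have "cmod (x z) \<le> 1/2" if "z \<in> K" for z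
    using le[OF that] nz[OF that] by (simp add: x_def norm_mult norm_divide field_simps)
  moreover have "(\<lambda>w. 1 / (1 + w)) holomorphic_on ball (0::complex) 1"
    by (intro holomorphic_intros) (auto simp: add_eq_0_iff)
  ultimately have "(\<lambda>z. 1 / (1 + x z)) \<in> poly_uniform_limits K"
    using poly_uniform_limits_holomorphic_compose[OF \<open>compact K\<close>, of x "\<lambda>w. 1 / (1 + w)"] by blast
  from poly_uniform_limits_mult[OF \<open>compact K\<close> inv this]
  show ?thesis
    by (rule poly_uniform_limits_cong) (use nz in \<open>auto simp: x_def field_simps\<close>)
qed

text \<open>Runge's pole pushing: \<open>1 / (z - \<zeta>)\<close> is a limit of polynomials when \<open>\<zeta>\<close> is large, and this property
passes from \<open>\<zeta>\<close> to nearby points by perturbation. It therefore spreads over the whole unbounded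
component \<open>outside K\<close>, which is connected.\<close>

lemma inverse_linear_in_poly_uniform_limits:
  assumes K: "compact K" and z: "\<zeta> \<in> outside K"
  shows "(\<lambda>z. 1 / (z - \<zeta>)) \<in> poly_uniform_limits K"
proof -
  have "connected (outside K)"
    using connected_outside[OF compact_imp_bounded[OF K]] by simp
  obtain R where R: "R > 0" "\<And>z. z \<in> K \<Longrightarrow> cmod z \<le> R"
    using compact_imp_bounded[OF K] unfolding bounded_pos by blast
  \<comment> \<open>For \<open>|b| > 2 R\<close> the function \<open>z - b\<close> is a small perturbation of the constant \<open>-b\<close>.\<close>
  obtain b where b: "b \<in> outside K" "cmod b > 2 * R"
    using unbounded_outside[OF compact_imp_bounded[OF K]] unfolding bounded_iff
    by (meson not_le)
  have base: "(\<lambda>z. 1 / (z - b)) \<in> poly_uniform_limits K"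
    by (rule poly_uniform_limits_inverse_perturb[OF K, of "\<lambda>z. - b"])
      (use b R in \<open>auto simp: norm_minus_commute intro: less_imp_le dest!: R(2)\<close>)
  show ?thesis
  proof (rule connected_induction_simple[OF \<open>connected (outside K)\<close> b(1) z,
        where P = "\<lambda>\<zeta>. (\<lambda>z. 1 / (z - \<zeta>)) \<in> poly_uniform_limits K", OF base])
    fix a assume "a \<in> outside K"
    moreover have "open (outside K)"
      using K by (simp add: compact_imp_closed open_outside)
    ultimately obtain r where r: "r > 0" "ball a r \<subseteq> outside K"
      unfolding open_contains_ball by blast
    have far: "dist a z \<ge> r" if "z \<in> K" for z
      using that r(2) outside_no_overlap[of K] by (meson disjoint_iff mem_ball not_le subsetD)
    \<comment> \<open>Two points of \<open>?T\<close> differ by less than \<open>2r/5\<close>, and their distance to \<open>K\<close> is at least \<open>4r/5\<close>.\<close>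
    let ?T = "ball a (r/5)"
    have "\<forall>x\<in>?T. \<forall>y\<in>?T. (\<lambda>z. 1 / (z - x)) \<in> poly_uniform_limits K \<longrightarrow>
         (\<lambda>z. 1 / (z - y)) \<in> poly_uniform_limits K"
    proof (intro ballI impI)
      fix x y assume xy: "x \<in> ?T" "y \<in> ?T" and inv: "(\<lambda>z. 1 / (z - x)) \<in> poly_uniform_limits K"
      have *: "cmod (x - y) \<le> cmod (z - x) / 2 \<and> z \<noteq> x" if "z \<in> K" for z
      proof -
        have "dist x y < 2 * r/5" using xy dist_triangle3[of x y a] by auto
        moreover have "dist a z \<le> dist a x + dist x z" by (rule dist_triangle)
        ultimately show ?thesis using xy far[OF that] r(1) by (auto simp: dist_norm norm_minus_commute)
      qed
      show "(\<lambda>z. 1 / (z - y)) \<in> poly_uniform_limits K"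
        by (rule poly_uniform_limits_inverse_perturb[OF K _ _ inv]) (use * in auto)
    qed
    moreover have "openin (top_of_set (outside K)) ?T"
      using r by (intro open_subset) auto
    ultimately show "\<exists>T. openin (top_of_set (outside K)) T \<and> a \<in> T \<and> (\<forall>x\<in>T. \<forall>y\<in>T.
         (\<lambda>z. 1 / (z - x)) \<in> poly_uniform_limits K \<longrightarrow> (\<lambda>z. 1 / (z - y)) \<in> poly_uniform_limits K)"
      using r(1) by (intro exI[of _ ?T]) auto
  qed
qed

section \<open>Peaking at points of the outer boundary\<close>

text \<open>The identity \<open>(s - 1)(s + 1) = x\<close> for \<open>s = csqrt (1 + x)\<close>, where \<open>|s + 1| \<ge> 1\<close> because the principal
root has nonnegative real part.\<close>

lemma csqrt_near_one:
  assumes "cmod x \<le> 1"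
  shows "cmod (csqrt (1 + x) - 1) \<le> cmod x"
proof -
  let ?s = "csqrt (1 + x)"
  have "Re ?s \<ge> 0" using csqrt_principal[of "1 + x"] by linarith
  then have "1 \<le> cmod (?s + 1)"
    using complex_Re_le_cmod[of "?s + 1"] unfolding plus_complex.sel one_complex.sel by linarith
  moreover have "(?s - 1) * (?s + 1) = x"
    using power2_csqrt[of "1 + x"] by (simp add: algebra_simps power2_eq_square)
  then have "cmod (?s - 1) * cmod (?s + 1) = cmod x" by (metis norm_mult)
  moreover have "cmod (?s - 1) * 1 \<le> cmod (?s - 1) * cmod (?s + 1)"
    using calculation by (intro mult_left_mono) auto
  ultimately show ?thesis by simp
qed

text \<open>If \<open>a\<close> and \<open>b\<close> lie in a connected subset \<open>S\<close> of \<open>outside K\<close>, then \<open>(z - b) / (z - a)\<close> has a square root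
among the limits of polynomials: at \<open>b = a\<close> the root is \<open>1\<close>, and when \<open>b\<close> moves a little from \<open>x\<close>
to \<open>y\<close> inside \<open>S\<close> the root is multiplied by \<open>csqrt ((z - y) / (z - x))\<close>, the principal root of a
function close to \<open>1\<close>. Near \<open>S\<close> nothing is said about the branch so obtained, since \<open>S\<close> may wind
around parts of \<open>K\<close>. Far from \<open>S\<close> it is the branch near \<open>1\<close>, because there the
ratio stays near \<open>1\<close> throughout the deformation; the sign condition on \<open>Re\<close> records this and is
carried along in the induction.\<close>

lemma sqrt_ratio_in_poly_uniform_limits:
  fixes r :: real
  assumes K: "compact K" and S: "connected S" "S \<subseteq> outside K" "S \<subseteq> cball z0 r"
    and ab: "a \<in> S" "b \<in> S"
  shows "\<exists>q\<in>poly_uniform_limits K. \<forall>z\<in>K. (q z)\<^sup>2 = (z - b) / (z - a)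
            \<and> (dist z0 z \<ge> 9 * r \<longrightarrow> Re (q z) \<ge> 0)"
proof (cases "r > 0")
  case False
  have "x = z0" if "x \<in> S" for x
  proof -
    have "x \<in> cball z0 r" using that S(3) by blast
    then have "dist z0 x \<le> 0" using False by (simp del: dist_le_zero_iff)
    then show ?thesis by simp
  qed
  then have "a = z0" "b = z0" using ab by auto
  moreover have "a \<notin> K" using subsetD[OF S(2) ab(1)] outside_no_overlap[of K] by blast
  ultimately show ?thesis by (intro bexI[of _ "\<lambda>z. 1"]) auto
next
  case True
  define P where "P = (\<lambda>b. \<exists>q\<in>poly_uniform_limits K. \<forall>z\<in>K. (q z)\<^sup>2 = (z - b) / (z - a)
            \<and> (dist z0 z \<ge> 9 * r \<longrightarrow> Re (q z) \<ge> 0))"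
  have outK: "z \<noteq> c" if "c \<in> S" "z \<in> K" for c z
    using that S(2) outside_no_overlap[of K] by blast
  have Pa: "P a"
    unfolding P_def using outK[OF ab(1)] by (intro bexI[of _ "\<lambda>z. 1"]) auto
  have "P b"
  proof (rule connected_induction_simple[OF S(1) ab(1) ab(2), where P = P, OF Pa])
    fix c assume c: "c \<in> S"
    have "open (outside K)" using K by (simp add: compact_imp_closed open_outside)
    with c S(2) obtain d where d: "d > 0" "ball c d \<subseteq> outside K"
      unfolding open_contains_ball by blast
    \<comment> \<open>For \<open>x\<close>, \<open>y\<close> in a set of this size the ratio \<open>(z - y) / (z - x)\<close> is within \<open>1/4\<close> of \<open>1\<close> on \<open>K\<close>.\<close>
    let ?T = "S \<inter> ball c (d/9)"
    have step: "P y" if x: "x \<in> ?T" and y: "y \<in> ?T" and Px: "P x" for x y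
    proof -
      obtain q where q: "q \<in> poly_uniform_limits K"
        and q2: "\<And>z. z \<in> K \<Longrightarrow> (q z)\<^sup>2 = (z - x) / (z - a)"
        and qRe: "\<And>z. z \<in> K \<Longrightarrow> dist z0 z \<ge> 9 * r \<Longrightarrow> Re (q z) \<ge> 0"
        using Px unfolding P_def by auto
      define e where "e = (\<lambda>z. (x - y) * (1 / (z - x)))"
      define s where "s = (\<lambda>z. csqrt (1 + e z))"
      have e_mem: "e \<in> poly_uniform_limits K"
        unfolding e_def using x S(2)
        by (intro poly_uniform_limits_mult K poly_uniform_limits_const inverse_linear_in_poly_uniform_limits) auto
      have e_le: "cmod (e z) \<le> 1/4" if z: "z \<in> K" for z
      proof -
        have "z \<notin> ball c d" using d(2) z outside_no_overlap[of K] by blast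
        then have far: "dist c z \<ge> d" by simp
        have "dist x y < 2 * d/9" using x y dist_triangle3[of x y c] by auto
        moreover have "dist c z \<le> dist c x + dist x z" by (rule dist_triangle)
        then have "dist x z \<ge> 8*d/9" using far x by auto
        ultimately have "cmod (x - y) \<le> (1/4) * cmod (z - x)"
          by (auto simp: dist_norm norm_minus_commute)
        then show ?thesis using outK[of x z] x z by (simp add: e_def norm_mult norm_divide divide_simps)
      qed
      have s_mem: "s \<in> poly_uniform_limits K"
        unfolding s_def
      proof (rule poly_uniform_limits_holomorphic_compose[OF K e_mem, of "\<lambda>w. csqrt (1 + w)"])
        show "cmod (e z) \<le> 1/2" if "z \<in> K" for z using e_le[OF that] by simp
        have "1 + w \<notin> \<real>\<^sub>\<le>\<^sub>0" if "cmod w < 1" for w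
          using that complex_Re_le_cmod[of "-w"] by (auto simp: complex_nonpos_Reals_iff)
        then show "(\<lambda>w. csqrt (1 + w)) holomorphic_on ball 0 1"
          by (intro holomorphic_intros) auto
      qed
      have "(q z * s z)\<^sup>2 = (z - y) / (z - a)" if z: "z \<in> K" for z
      proof -
        have "z \<noteq> x" "z \<noteq> a" using outK z x ab by auto
        moreover have "(q z * s z)\<^sup>2 = (z - x) / (z - a) * (1 + e z)"
          using q2[OF z] by (simp add: power_mult_distrib s_def)
        ultimately show ?thesis by (simp add: e_def divide_simps)
      qed
      moreover have "Re (q z * s z) \<ge> 0" if z: "z \<in> K" and far: "dist z0 z \<ge> 9 * r" for z
      proof -
        \<comment> \<open>Both \<open>q z\<close> and \<open>s z\<close> are within \<open>1/4\<close> of \<open>1\<close>, so their product stays in the right half plane.\<close>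
        have nz: "z \<noteq> a" using outK z ab by auto
        have "x \<in> cball z0 r" "a \<in> cball z0 r" using x ab S(3) by auto
        then have "dist x a \<le> 2 * r" using dist_triangle3[of x a z0] by auto
        moreover have "dist z0 z \<le> dist z0 a + dist a z" by (rule dist_triangle)
        then have "dist a z \<ge> 8 * r" using \<open>a \<in> cball z0 r\<close> far by auto
        ultimately have "cmod (a - x) \<le> (1/4) * cmod (z - a)"
          by (auto simp: dist_norm norm_minus_commute)
        moreover have eq: "(q z)\<^sup>2 - 1 = (a - x) / (z - a)"
          using nz q2[OF z] by (simp add: divide_simps) (simp add: algebra_simps)
        ultimately have "cmod ((q z)\<^sup>2 - 1) \<le> 1/4"
          unfolding eq norm_divide using nz by (simp add: divide_simps)
        have near: "cmod (q z - 1) \<le> 1/4"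
        proof -
          have "1 \<le> cmod (q z + 1)" using complex_Re_le_cmod[of "q z + 1"] qRe[OF z far] by simp
          then have "cmod (q z - 1) * 1 \<le> cmod (q z - 1) * cmod (q z + 1)"
            by (intro mult_left_mono) auto
          also have "\<dots> = cmod ((q z)\<^sup>2 - 1)"
            by (simp flip: norm_mult add: algebra_simps power2_eq_square)
          finally show ?thesis using \<open>cmod ((q z)\<^sup>2 - 1) \<le> 1/4\<close> by simp
        qed
        have snear: "cmod (s z - 1) \<le> 1/4"
          using csqrt_near_one[of "e z"] e_le[OF z] by (simp add: s_def)
        have "cmod (q z * s z - 1) = cmod ((q z - 1) * (s z - 1) + (q z - 1) + (s z - 1))"
          by (simp add: algebra_simps)
        also have "\<dots> \<le> cmod (q z - 1) * cmod (s z - 1) + cmod (q z - 1) + cmod (s z - 1)"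
          by (metis (no_types, opaque_lifting) norm_mult norm_triangle_mono order_refl)
        also have "\<dots> \<le> 1/4 * (1/4) + 1/4 + 1/4"
          by (intro add_mono mult_mono near snear) auto
        finally show ?thesis
          using complex_Re_le_cmod[of "1 - q z * s z"] by (simp add: norm_minus_commute)
      qed
      ultimately show "P y"
        unfolding P_def by (intro bexI[of _ "\<lambda>z. q z * s z"] poly_uniform_limits_mult K q s_mem) auto
    qed
    have "openin (top_of_set S) ?T" by (simp add: openin_open_Int)
    then show "\<exists>T. openin (top_of_set S) T \<and> c \<in> T \<and> (\<forall>x\<in>T. \<forall>y\<in>T. P x \<longrightarrow> P y)"
    proof (intro exI[of _ ?T] conjI ballI impI)
      show "c \<in> ?T" using c d(1) by simp
      show "P y" if "x \<in> ?T" "y \<in> ?T" "P x" for x y using step that .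
    qed
  qed
  then show ?thesis unfolding P_def .
qed

text \<open>The set \<open>S\<close> is the initial piece of a path that leads, inside \<open>outside K\<close>, from a point close to
\<open>z0\<close> out of the disc. The point \<open>z0\<close> itself may be inaccessible from \<open>outside K\<close>, which is why
only points near it are joined to the circle.\<close>

lemma outside_crosscut:
  fixes K :: "complex set"
  assumes K: "compact K" and z0: "z0 \<in> closure (outside K)" and r: "r > 0" "s > 0" "s \<le> r"
  obtains S a b where "connected S" "S \<subseteq> outside K" "S \<subseteq> cball z0 r"
    "a \<in> S" "b \<in> S" "dist z0 a = r" "dist z0 b < s"
proof -
  obtain b where b: "b \<in> outside K" "dist z0 b < s"
    using z0 r(2) unfolding closure_approachable by (metis dist_commute)
  obtain c where c: "c \<in> outside K" "c \<notin> cball z0 r"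
    using unbounded_outside[OF compact_imp_bounded[OF K]] bounded_subset[OF bounded_cball] by blast
  have "connected (outside K)"
    using connected_outside[OF compact_imp_bounded[OF K]] by simp
  then have "path_connected (outside K)"
    using K by (simp add: compact_imp_closed open_outside connected_open_path_connected)
  then obtain g where g: "path g" "path_image g \<subseteq> outside K" "pathstart g = b" "pathfinish g = c"
    using b c unfolding path_connected_def by metis
  have "pathstart g \<in> closure (cball z0 r)" using g b r by simp
  then obtain h where h: "path h" "pathstart h = pathstart g" "path_image h \<subseteq> path_image g"
      "path_image h - {pathfinish h} \<subseteq> interior (cball z0 r)" "pathfinish h \<in> frontier (cball z0 r)"
    using exists_path_subpath_to_frontier[of g "cball z0 r"] g c by blast
  have "dist z0 (pathfinish h) = r" using h(5) by (simp add: frontier_cball)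
  moreover have "path_image h \<subseteq> cball z0 r"
  proof
    fix x assume "x \<in> path_image h"
    then show "x \<in> cball z0 r"
      using h(4) interior_subset[of "cball z0 r"] \<open>dist z0 (pathfinish h) = r\<close>
      by (cases "x = pathfinish h") auto
  qed
  moreover have "pathstart h \<in> path_image h" "pathfinish h \<in> path_image h" by auto
  ultimately show ?thesis
    using that[of "path_image h" "pathfinish h" b] connected_path_image[OF h(1)] h g b by auto
qed

text \<open>Take \<open>S\<close>, \<open>a\<close>, \<open>b\<close> from a crosscut, with \<open>b\<close> very close to \<open>z0\<close>, and let \<open>q\<close> be the square root of
\<open>(z - b) / (z - a)\<close>. Then \<open>F = (1 - q) / (1 + q)\<close> is not small at \<open>z0\<close>, where \<open>|q| \<le> 1/3\<close>, and
decays like \<open>r / |z - z0|\<close> far away, where \<open>q\<close> is near \<open>1\<close>. As in Koebe's covering argument, \<open>q\<close> avoids a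
neighbourhood of \<open>-1\<close> of fixed size, so \<open>F\<close> is bounded by a constant that depends on nothing.
That \<open>F\<close> is again a limit of polynomials follows without any division by \<open>1 + q\<close>: the identity
\<open>1 - q\<^sup>2 = (b - a) / (z - a)\<close> turns it into \<open>(1 - q)\<^sup>2 (z - a) / (b - a)\<close>.\<close>

lemma bounded_peaking_limit:
  assumes K: "compact K" and z0: "z0 \<in> K" "z0 \<in> closure (outside K)" and r: "r > 0"
  obtains F where "F \<in> poly_uniform_limits K" "cmod (F z0) \<ge> 1/2"
    "\<And>z. z \<in> K \<Longrightarrow> cmod (F z) \<le> 180"
    "\<And>z. z \<in> K \<Longrightarrow> dist z0 z \<ge> 9 * r \<Longrightarrow> cmod (F z) * (dist z0 z - r) \<le> 2 * r"
proof -
  obtain S a b where S: "connected S" "S \<subseteq> outside K" "S \<subseteq> cball z0 r"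
    and ab: "a \<in> S" "b \<in> S" "dist z0 a = r" "dist z0 b < r/9"
    using outside_crosscut[OF K z0(2) r, of "r/9"] r by auto
  obtain q where q: "q \<in> poly_uniform_limits K" "\<And>z. z \<in> K \<Longrightarrow> (q z)\<^sup>2 = (z - b) / (z - a)"
    and qRe: "\<And>z. z \<in> K \<Longrightarrow> dist z0 z \<ge> 9 * r \<Longrightarrow> Re (q z) \<ge> 0"
    using sqrt_ratio_in_poly_uniform_limits[OF K S ab(1) ab(2)] by auto
  define F where "F = (\<lambda>z. (1 - q z)\<^sup>2 * ((z - a) * (1 / (b - a))))"
  have F_mem: "F \<in> poly_uniform_limits K"
    unfolding F_def
    by (intro poly_uniform_limits_mult poly_uniform_limits_power poly_uniform_limits_minus
        poly_uniform_limits_const poly_uniform_limits_linear K q)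
  have dab: "dist a b \<ge> r/2" "dist a b \<le> 2 * r"
    using dist_triangle[of z0 a b] dist_triangle3[of a b z0] ab r by (auto simp: dist_commute)
  then have "a \<noteq> b" using r by auto
  have nz: "z \<noteq> a" if "z \<in> K" for z
    using that subsetD[OF S(2) ab(1)] outside_no_overlap[of K] by blast
  have q1: "(1 - q z) * (1 + q z) = (b - a) / (z - a)" if "z \<in> K" for z
  proof -
    have "(1 - q z) * (1 + q z) = 1 - (q z)\<^sup>2" by (simp add: algebra_simps power2_eq_square)
    then show ?thesis using nz[OF that] q(2)[OF that] by (simp add: divide_simps)
  qed
  have F_eq: "F z * (1 + q z) = 1 - q z" if "z \<in> K" for z
  proof -
    have "F z * (1 + q z) = (1 - q z) * ((1 - q z) * (1 + q z)) * ((z - a) / (b - a))"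
      by (simp add: F_def power2_eq_square)
    then show ?thesis using q1[OF that] nz[OF that] \<open>a \<noteq> b\<close> by simp
  qed
  show ?thesis
  proof
    show "F \<in> poly_uniform_limits K" by (rule F_mem)
    show "cmod (F z0) \<ge> 1/2"
    proof -
      have "cmod (q z0) ^ 2 = dist z0 b / dist z0 a"
        using q(2)[OF z0(1)] by (simp add: norm_divide dist_norm flip: norm_power)
      also have "\<dots> \<le> (1/3)\<^sup>2" using ab r by (simp add: power2_eq_square)
      finally have q0: "cmod (q z0) \<le> 1/3" by (rule power2_le_imp_le) simp
      have "2/3 \<le> cmod (1 - q z0)" "cmod (1 + q z0) \<le> 4/3"
        using q0 norm_triangle_ineq2[of 1 "q z0"] norm_triangle_ineq[of 1 "q z0"] by auto
      moreover have "cmod (F z0) * cmod (1 + q z0) = cmod (1 - q z0)"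
        by (metis F_eq[OF z0(1)] norm_mult)
      moreover have "cmod (F z0) * cmod (1 + q z0) \<le> cmod (F z0) * (4/3)"
        using calculation by (intro mult_left_mono) auto
      ultimately show ?thesis by simp
    qed
    have far: "cmod (F z) * (dist z0 z - r) \<le> 2 * r" if z: "z \<in> K" and d: "dist z0 z \<ge> 9 * r" for z
    proof -
      have "1 \<le> cmod (1 + q z)" using complex_Re_le_cmod[of "1 + q z"] qRe[OF z d] by simp
      then have "cmod (F z) * 1 \<le> cmod (F z) * cmod (1 + q z)"
          "cmod (1 - q z) * 1 \<le> cmod (1 - q z) * cmod (1 + q z)"
        by (intro mult_left_mono; simp)+
      moreover have "cmod (F z) * cmod (1 + q z) = cmod (1 - q z)" by (metis F_eq[OF z] norm_mult)
      moreover have "cmod (1 - q z) * cmod (1 + q z) = dist a b / dist z a"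
        using q1[OF z] by (metis dist_norm dist_commute norm_divide norm_mult)
      ultimately have "cmod (F z) \<le> dist a b / dist z a" by linarith
      then have "cmod (F z) * dist z a \<le> dist a b" using nz[OF z] by (simp add: divide_simps split: if_splits)
      moreover have "dist z0 z \<le> dist z0 a + dist z a" by (metis dist_triangle2 add.commute)
      then have "cmod (F z) * (dist z0 z - r) \<le> cmod (F z) * dist z a"
        using ab by (intro mult_left_mono) auto
      ultimately show ?thesis using dab by linarith
    qed
    show "dist z0 z \<ge> 9 * r \<Longrightarrow> cmod (F z) * (dist z0 z - r) \<le> 2 * r" if "z \<in> K" for z
      using far that by blast
    show "cmod (F z) \<le> 180" if z: "z \<in> K" for z
    proof (cases "dist z0 z \<ge> 9 * r")
      case True
      have "cmod (F z) * (2 * r) \<le> cmod (F z) * (dist z0 z - r)"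
        using True r by (intro mult_left_mono) auto
      then have "cmod (F z) * (2 * r) \<le> 1 * (2 * r)" using far[OF z True] by linarith
      then show ?thesis using r by (auto dest: mult_right_le_imp_le)
    next
      case False
      show ?thesis
      \<comment> \<open>For bounded \<open>q\<close> the product formula bounds \<open>F\<close>; for \<open>|q| > 2\<close> the quotient \<open>(1 - q) / (1 + q)\<close> has modulus at most \<open>3\<close>.\<close>
      proof (cases "cmod (q z) \<le> 2")
        case True
        have "dist z a \<le> 10 * r" using False ab dist_triangle3[of z a z0] by auto
        then have "dist z a / dist a b \<le> 10 * r / (r / 2)"
          using dab r by (intro frac_le) auto
        then have *: "dist z a / dist a b \<le> 20" using r by simp
        have "cmod (1 - q z) \<le> 3" using True norm_triangle_ineq4[of 1 "q z"] by simp
        then have "cmod (1 - q z) ^ 2 \<le> 3 ^ 2" by (intro power_mono) auto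
        moreover have "cmod (F z) = cmod (1 - q z) ^ 2 * (dist z a / dist a b)"
          by (simp add: F_def norm_mult norm_divide norm_power dist_norm norm_minus_commute)
        ultimately show ?thesis using mult_mono[OF _ *, of "cmod (1 - q z) ^ 2" 9] by simp
      next
        case False
        then have q2: "cmod (q z) > 2" by simp
        then have "cmod (1 - q z) \<le> cmod (q z) + 1" "cmod (1 + q z) \<ge> cmod (q z) - 1"
          using norm_triangle_ineq4[of 1 "q z"] norm_triangle_ineq2[of "q z" "-1"] by (auto simp: add.commute)
        moreover have "cmod (F z) * cmod (1 + q z) = cmod (1 - q z)" by (metis F_eq[OF z] norm_mult)
        moreover have "cmod (F z) * (cmod (q z) - 1) \<le> cmod (F z) * cmod (1 + q z)"
          using calculation by (intro mult_left_mono) auto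
        ultimately have "cmod (F z) * (cmod (q z) - 1) \<le> cmod (q z) + 1" by simp
        also have "\<dots> \<le> 3 * (cmod (q z) - 1)" using q2 by simp
        finally have "cmod (F z) * (cmod (q z) - 1) \<le> 3 * (cmod (q z) - 1)" .
        then have "cmod (F z) \<le> 3" by (rule mult_right_le_imp_le) (use q2 in simp)
        then show ?thesis by simp
      qed
    qed
  qed
qed

text \<open>The function of the preceding lemma for a radius \<open>r\<close> much smaller than \<open>\<rho>\<close>, approximated by a
polynomial and normalised at \<open>z0\<close>. What matters is that the bound \<open>800\<close> depends on neither \<open>\<rho>\<close>
nor \<open>\<delta>\<close>.\<close>

lemma bounded_peaking_polynomial:
  assumes K: "compact K" and z0: "z0 \<in> K" "z0 \<in> closure (outside K)"
    and "\<rho> > 0" "\<delta> > 0"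
  obtains f where "poly f z0 = 1" "\<And>z. z \<in> K \<Longrightarrow> cmod (poly f z) \<le> 800"
    "\<And>z. z \<in> K \<Longrightarrow> dist z0 z \<ge> \<rho> \<Longrightarrow> cmod (poly f z) \<le> \<delta>"
proof -
  define \<eta> where "\<eta> = min \<delta> 1 / 8"
  have \<eta>: "\<eta> > 0" "\<eta> \<le> 1/8" "8 * \<eta> \<le> \<delta>" using assms by (auto simp: \<eta>_def)
  \<comment> \<open>Chosen so that \<open>9 r \<le> \<rho>\<close> and \<open>2 r / (\<rho> - r) < \<eta>\<close>, the decay estimate at distance \<open>\<rho>\<close>.\<close>
  define r where "r = \<rho> * \<eta> / (3 + 9 * \<eta>)"
  have r: "r > 0" using assms \<eta> by (simp add: r_def)
  have r': "r * (3 + 9 * \<eta>) = \<rho> * \<eta>" using \<eta> by (simp add: r_def)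
  have "9 * r * \<eta> \<le> \<rho> * \<eta>" using r' r by (simp add: algebra_simps)
  then have r9: "9 * r \<le> \<rho>" using \<eta>(1) by simp
  have "3 * r + \<eta> * r \<le> \<rho> * \<eta>" using r' mult_pos_pos[OF r \<eta>(1)] by (simp add: algebra_simps)
  then have r2: "2 * r < (\<rho> - r) * \<eta>" using r by (simp add: algebra_simps)
  obtain F where F: "F \<in> poly_uniform_limits K" "cmod (F z0) \<ge> 1/2"
    "\<And>z. z \<in> K \<Longrightarrow> cmod (F z) \<le> 180"
    "\<And>z. z \<in> K \<Longrightarrow> dist z0 z \<ge> 9 * r \<Longrightarrow> cmod (F z) * (dist z0 z - r) \<le> 2 * r"
    using bounded_peaking_limit[OF K z0 r] by blast
  obtain p where p: "\<And>z. z \<in> K \<Longrightarrow> cmod (poly p z - F z) < \<eta>"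
    using F(1) \<eta>(1) unfolding poly_uniform_limits_iff by blast
  have p0: "cmod (poly p z0) \<ge> 1/4"
    using p[OF z0(1)] F(2) \<eta> norm_triangle_ineq2[of "F z0" "poly p z0"] by (simp add: norm_minus_commute)
  have le: "cmod (poly (smult (1 / poly p z0) p) z) \<le> 4 * cmod (poly p z)" for z
  proof -
    have "cmod (poly p z) * 1 \<le> cmod (poly p z) * (4 * cmod (poly p z0))"
      using p0 by (intro mult_left_mono) auto
    then show ?thesis using p0 by (simp add: norm_mult norm_divide divide_simps)
  qed
  show ?thesis
  proof (rule that[of "smult (1 / poly p z0) p"])
    show "poly (smult (1 / poly p z0) p) z0 = 1" using p0 by auto
    fix z assume z: "z \<in> K"
    have pz: "cmod (poly p z) \<le> cmod (F z) + \<eta>"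
      using p[OF z] norm_triangle_ineq2[of "poly p z" "F z"] by simp
    show "cmod (poly (smult (1 / poly p z0) p) z) \<le> 800"
      using le[of z] pz F(3)[OF z] \<eta> by linarith
    assume d: "dist z0 z \<ge> \<rho>"
    have "cmod (F z) * (\<rho> - r) \<le> cmod (F z) * (dist z0 z - r)"
      using d by (intro mult_left_mono) auto
    also have "\<dots> \<le> 2 * r" using F(4)[OF z] d r9 by auto
    also have "\<dots> \<le> \<eta> * (\<rho> - r)" using r2 by (simp add: mult.commute)
    finally have "cmod (F z) \<le> \<eta>" using r9 r by (auto dest: mult_right_le_imp_le)
    then show "cmod (poly (smult (1 / poly p z0) p) z) \<le> \<delta>"
      using le[of z] pz \<eta> by linarith
  qed
qed

text \<open>Bishop's averaging lowers the uniform bound \<open>800\<close> to \<open>1 + \<epsilon>\<close>. Add \<open>n\<close> of the polynomials above, each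
new one peaking on a neighbourhood so small that the sum of the earlier ones still has modulus at
most their number plus \<open>1\<close> there. At every point at most one summand contributes more than about
\<open>1\<close>, so the sum is at most \<open>n + 801\<close>, and division by a large \<open>n\<close> gives the bound.\<close>

lemma peaking_polynomial:
  assumes K: "compact K" and z0: "z0 \<in> K" "z0 \<in> closure (outside K)"
    and "\<rho> > 0" "\<delta> > 0" "\<delta> \<le> 1" "\<epsilon> > 0"
  obtains f where "poly f z0 = 1" "\<And>z. z \<in> K \<Longrightarrow> cmod (poly f z) \<le> 1 + \<epsilon>"
    "\<And>z. z \<in> K \<Longrightarrow> dist z0 z \<ge> \<rho> \<Longrightarrow> cmod (poly f z) \<le> \<delta>"
proof -
  have sum: "\<exists>g. poly g z0 = of_nat n \<and> (\<forall>z\<in>K. cmod (poly g z) \<le> n + 801 \<and>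
               (dist z0 z \<ge> \<rho> \<longrightarrow> cmod (poly g z) \<le> n * \<delta>))" for n :: nat
  proof (induction n)
    case 0
    show ?case by (rule exI[of _ 0]) auto
  next
    case (Suc n)
    then obtain g where g0: "poly g z0 = of_nat n"
      and g: "\<And>z. z \<in> K \<Longrightarrow> cmod (poly g z) \<le> n + 801"
      and gfar: "\<And>z. z \<in> K \<Longrightarrow> dist z0 z \<ge> \<rho> \<Longrightarrow> cmod (poly g z) \<le> n * \<delta>"
      by blast
    have "continuous (at z0) (\<lambda>z. poly g z)" by (intro continuous_intros)
    then obtain d where d: "d > 0" "\<And>z. dist z z0 < d \<Longrightarrow> dist (poly g z) (poly g z0) < 1"
      unfolding continuous_at_eps_delta by (metis zero_less_one)
    obtain f where f: "poly f z0 = 1" "\<And>z. z \<in> K \<Longrightarrow> cmod (poly f z) \<le> 800"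
      "\<And>z. z \<in> K \<Longrightarrow> dist z0 z \<ge> min d \<rho> \<Longrightarrow> cmod (poly f z) \<le> \<delta>"
      using bounded_peaking_polynomial[OF K z0, of "min d \<rho>" \<delta>] assms d(1) by auto
    show ?case
    proof (intro exI[of _ "g + f"] conjI ballI impI)
      show "poly (g + f) z0 = of_nat (Suc n)" using g0 f(1) by simp
      fix z assume z: "z \<in> K"
      have tri: "cmod (poly (g + f) z) \<le> cmod (poly g z) + cmod (poly f z)"
        by (simp add: norm_triangle_ineq)
      show "cmod (poly (g + f) z) \<le> Suc n + 801"
      proof (cases "dist z0 z < d")
        case True
        then have "cmod (poly g z) \<le> n + 1"
          using d(2)[of z] g0 norm_triangle_ineq2[of "poly g z" "of_nat n"]
          by (simp add: dist_norm norm_minus_commute)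
        then show ?thesis using tri f(2)[OF z] by simp
      next
        case False
        then have "cmod (poly f z) \<le> 1" using f(3)[OF z] assms by force
        then show ?thesis using tri g[OF z] by simp
      qed
      assume "dist z0 z \<ge> \<rho>"
      then show "cmod (poly (g + f) z) \<le> Suc n * \<delta>"
        using tri gfar[OF z] f(3)[OF z] min.cobounded2[of d \<rho>] by (simp add: algebra_simps)
    qed
  qed
  obtain n where n: "real n > 801 / \<epsilon>" using reals_Archimedean2 by blast
  then have n0: "real n > 0" using \<open>\<epsilon> > 0\<close> by (metis divide_pos_pos less_trans zero_less_numeral)
  obtain g where g: "poly g z0 = of_nat n" "\<And>z. z \<in> K \<Longrightarrow> cmod (poly g z) \<le> n + 801"
      "\<And>z. z \<in> K \<Longrightarrow> dist z0 z \<ge> \<rho> \<Longrightarrow> cmod (poly g z) \<le> n * \<delta>"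
    using sum[of n] by blast
  show ?thesis
  proof (rule that[of "smult (1 / of_nat n) g"])
    show "poly (smult (1 / of_nat n) g) z0 = 1" using g(1) n0 by simp
    fix z assume z: "z \<in> K"
    have eq: "cmod (poly (smult (1 / of_nat n) g) z) = cmod (poly g z) / n"
      by (simp add: norm_mult norm_divide)
    have "801 < \<epsilon> * n" using n \<open>\<epsilon> > 0\<close> by (simp add: field_simps)
    then show "cmod (poly (smult (1 / of_nat n) g) z) \<le> 1 + \<epsilon>"
      unfolding eq using g(2)[OF z] n0 by (simp add: field_simps)
    assume "dist z0 z \<ge> \<rho>"
    then show "cmod (poly (smult (1 / of_nat n) g) z) \<le> \<delta>"
      unfolding eq using g(3)[OF z] n0 by (simp add: field_simps)
  qed
qed

text \<open>A point of \<open>K\<close> with a neighbourhood \<open>U\<close> that misses \<open>outside K\<close> is interior to \<open>K \<union> inside K\<close>, so the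
frontier of that set is contained in \<open>K - U\<close>. By the maximum modulus principle \<open>K - U\<close> is then a
smaller closed boundary, against the minimality of \<open>K\<close>.\<close>

lemma shilov_imp_outer_boundary:
  assumes K: "compact K" and sh: "is_shilov_boundary K K"
  shows "K \<subseteq> closure (outside K)"
proof (rule ccontr)
  assume "\<not> K \<subseteq> closure (outside K)"
  then obtain z0 where z0: "z0 \<in> K" "z0 \<notin> closure (outside K)" by blast
  define U where "U = - closure (outside K)"
  define T where "T = K \<union> inside K"
  have TU: "U \<subseteq> T" unfolding U_def T_def union_with_inside using closure_subset by blast
  have openU: "open U" unfolding U_def by (rule open_Compl[OF closed_closure])
  have bT: "bounded T" unfolding T_def using K by (simp add: compact_imp_bounded bounded_inside)
  have clT: "closed T"
    unfolding T_def union_with_inside by (intro closed_Compl open_outside compact_imp_closed K)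
  have "inside K \<subseteq> interior T"
    using K by (intro interior_maximal) (auto simp: T_def compact_imp_closed open_inside)
  moreover have "U \<subseteq> interior T" using TU openU by (rule interior_maximal)
  moreover have "frontier T = T - interior T"
    using clT by (simp add: frontier_def closure_closed)
  ultimately have fr: "frontier T \<subseteq> K - U" unfolding T_def by blast
  define B where "B = K - U"
  have "T \<noteq> {}" using z0 by (auto simp: T_def)
  moreover have "T \<noteq> UNIV" using bT not_bounded_UNIV by blast
  ultimately have "frontier T \<noteq> {}" by (rule frontier_not_empty)
  then have B0: "B \<noteq> {}" using fr by (auto simp: B_def)
  have Bcomp: "compact B" unfolding B_def using K openU by (rule compact_diff)
  have BK: "B \<subseteq> K" by (auto simp: B_def)
  have mm: "cmod (poly p z) \<le> c" if "\<And>w. w \<in> B \<Longrightarrow> cmod (poly p w) \<le> c" "z \<in> K" for p z c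
  proof (rule maximum_modulus_frontier[of "poly p" T])
    show "poly p holomorphic_on interior T"
      using field_differentiable_at_within poly_DERIV
      unfolding holomorphic_on_def field_differentiable_def by blast
    show "continuous_on (closure T) (poly p)"
      using continuous_on_poly[OF continuous_on_id, of "closure T" p] by simp
    show "bounded T" by (rule bT)
    show "cmod (poly p z) \<le> c" if "z \<in> frontier T" for z
      using that fr \<open>\<And>w. w \<in> B \<Longrightarrow> cmod (poly p w) \<le> c\<close> by (auto simp: B_def)
    show "z \<in> T" using that by (simp add: T_def)
  qed
  have "closed_boundary K B"
    unfolding closed_boundary_def
  proof (intro conjI ballI)
    show "closed B" "B \<subseteq> K" "B \<noteq> {}" using Bcomp BK B0 by (auto intro: compact_imp_closed)
    fix f assume f: "f \<in> poly_uniform_limits K"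
    have contf: "continuous_on K f" by (rule poly_uniform_limits_continuous[OF f])
    then have "compact ((\<lambda>z. cmod (f z)) ` K)"
      using K by (intro compact_continuous_image continuous_intros)
    then have bdd: "bdd_above ((\<lambda>z. cmod (f z)) ` K)"
      by (intro bounded_imp_bdd_above compact_imp_bounded)
    then have bddB: "bdd_above ((\<lambda>z. cmod (f z)) ` B)" by (rule bdd_above_mono) (use BK in auto)
    show "sup_norm K f = sup_norm B f"
    proof (rule antisym)
      show "sup_norm B f \<le> sup_norm K f"
        unfolding sup_norm_def by (rule cSUP_subset_mono) (use B0 BK bdd in auto)
      show "sup_norm K f \<le> sup_norm B f"
        unfolding sup_norm_def
      proof (rule cSUP_least)
        show "K \<noteq> {}" using z0 by auto
        fix z assume z: "z \<in> K"
        show "cmod (f z) \<le> (SUP z\<in>B. cmod (f z))"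
        proof (rule field_le_epsilon)
          fix e :: real assume "e > 0"
          then obtain p where p: "\<And>z. z \<in> K \<Longrightarrow> cmod (poly p z - f z) < e/2"
            using f unfolding poly_uniform_limits_iff by (meson half_gt_zero)
          have "cmod (poly p w) \<le> (SUP z\<in>B. cmod (f z)) + e/2" if "w \<in> B" for w
          proof -
            have "cmod (f w) \<le> (SUP z\<in>B. cmod (f z))" using that bddB by (rule cSUP_upper)
            moreover have "cmod (poly p w) \<le> cmod (f w) + e/2"
              using p[of w] that BK norm_triangle_ineq2[of "poly p w" "f w"] by force
            ultimately show ?thesis by linarith
          qed
          then have "cmod (poly p z) \<le> (SUP z\<in>B. cmod (f z)) + e/2" using mm z by blast
          then show "cmod (f z) \<le> (SUP z\<in>B. cmod (f z)) + e"
            using p[OF z] norm_triangle_ineq2[of "f z" "poly p z"] by (simp add: norm_minus_commute)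
        qed
      qed
    qed
  qed
  then have "K \<subseteq> B" using sh unfolding is_shilov_boundary_def by blast
  then show False using z0 by (auto simp: B_def U_def)
qed

section \<open>Absorbing poles into polynomials of bounded degree\<close>

text \<open>A substitute for uniform approximation of \<open>1 / (z - \<zeta>)\<close> on \<open>K\<close> by polynomials: the bound is one-sided
except at \<open>z1\<close>, and \<open>f\<close> may change with \<open>z1\<close>. This is true even for poles in the holes of \<open>K\<close>, where
approximation can fail, provided that polynomials peak at the points of \<open>K\<close>. The essential point is
the bound \<open>D\<close> on the degree, uniform in \<open>z1\<close> and \<open>\<zeta>\<close>.\<close>

definition poles_absorbed :: "complex set \<Rightarrow> complex set \<Rightarrow> bool" where
  "poles_absorbed K P \<longleftrightarrow>
     (\<forall>t>1. \<exists>D. \<forall>z1\<in>K. \<forall>\<zeta>\<in>P. \<exists>f. degree f \<le> D \<and> poly f z1 = 1 \<and>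
        (\<forall>z\<in>K. cmod (poly f z) * cmod (z - \<zeta>) \<le> t * cmod (z1 - \<zeta>)))"

lemma disjoint_compact_distances:
  fixes K P :: "complex set"
  assumes "compact K" "compact P" "K \<inter> P = {}"
  obtains d R where "0 < d" "d \<le> R" "\<And>z \<zeta>. z \<in> K \<Longrightarrow> \<zeta> \<in> P \<Longrightarrow> d \<le> cmod (z - \<zeta>) \<and> cmod (z - \<zeta>) \<le> R"
proof -
  obtain d where d: "d > 0" "\<And>z \<zeta>. z \<in> K \<Longrightarrow> \<zeta> \<in> P \<Longrightarrow> d \<le> dist z \<zeta>"
    using separate_compact_closed[OF assms(1) compact_imp_closed[OF assms(2)] assms(3)] by blast
  obtain R1 R2 where R: "\<And>z. z \<in> K \<Longrightarrow> cmod z \<le> R1" "\<And>z. z \<in> P \<Longrightarrow> cmod z \<le> R2"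
    using assms(1,2)[THEN compact_imp_bounded] unfolding bounded_iff by blast
  show ?thesis
  proof (rule that[of d "max d (R1 + R2)"])
    fix z \<zeta> assume zz: "z \<in> K" "\<zeta> \<in> P"
    show "d \<le> cmod (z - \<zeta>) \<and> cmod (z - \<zeta>) \<le> max d (R1 + R2)"
      using d(2)[OF zz] R(1)[OF zz(1)] R(2)[OF zz(2)] norm_triangle_ineq4[of z \<zeta>]
      by (auto simp: dist_norm le_max_iff_disj)
  qed (use d in auto)
qed

text \<open>The compactness argument that turns local existence of a polynomial into a uniform bound on its
degree. It is applied to the points of \<open>K\<close> in one case and to the poles in the other.\<close>

lemma compact_degree_bound:
  fixes X :: "complex set" and Q :: "complex \<Rightarrow> 'a::zero poly \<Rightarrow> bool"
  assumes "compact X"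
    and "\<And>x. x \<in> X \<Longrightarrow> \<exists>e>0. \<exists>D. \<forall>y\<in>X. dist x y < e \<longrightarrow> (\<exists>f. degree f \<le> D \<and> Q y f)"
  shows "\<exists>D. \<forall>y\<in>X. \<exists>f. degree f \<le> D \<and> Q y f"
proof -
  obtain e D where e: "\<And>x. x \<in> X \<Longrightarrow> e x > 0"
    and D: "\<And>x y. x \<in> X \<Longrightarrow> y \<in> X \<Longrightarrow> dist x y < e x \<Longrightarrow> \<exists>f. degree f \<le> D x \<and> Q y f"
    using assms(2) by metis
  obtain F where F: "F \<subseteq> X" "finite F" "X \<subseteq> (\<Union>x\<in>F. ball x (e x))"
    by (rule compactE_image[OF assms(1), of X "\<lambda>x. ball x (e x)"]) (use e in auto)
  show ?thesis
  proof (intro exI[of _ "Max (D ` F)"] ballI)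
    fix y assume "y \<in> X"
    then obtain x where x: "x \<in> F" "dist x y < e x" using F(3) by auto
    then obtain f where "degree f \<le> D x" "Q y f" using D[of x y] F(1) \<open>y \<in> X\<close> by auto
    moreover have "D x \<le> Max (D ` F)" using x F(2) by auto
    ultimately show "\<exists>f. degree f \<le> Max (D ` F) \<and> Q y f" by (meson order_trans)
  qed
qed

text \<open>A polynomial that peaks at \<open>z0\<close> serves for all poles at once: near \<open>z0\<close> the distance to a pole is
almost constant and the polynomial is at most about \<open>1\<close>, while elsewhere the polynomial is so small
that it compensates the variation of the distance. It also serves for all \<open>z1\<close> near \<open>z0\<close>, after
normalisation at \<open>z1\<close>.\<close>

lemma poles_absorbed_outer_boundary:
  assumes K: "compact K" and P: "compact P" and disj: "K \<inter> P = {}"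
    and outer: "K \<subseteq> closure (outside K)"
  shows "poles_absorbed K P"
  unfolding poles_absorbed_def
proof (intro allI impI)
  fix t :: real assume t: "t > 1"
  define Q where "Q = (\<lambda>z1 f. poly f z1 = 1 \<and>
        (\<forall>\<zeta>\<in>P. \<forall>z\<in>K. cmod (poly f z) * cmod (z - \<zeta>) \<le> t * cmod (z1 - \<zeta>)))"
  obtain d R where dR: "0 < d" "d \<le> R"
    "\<And>z \<zeta>. z \<in> K \<Longrightarrow> \<zeta> \<in> P \<Longrightarrow> d \<le> cmod (z - \<zeta>) \<and> cmod (z - \<zeta>) \<le> R"
    using disjoint_compact_distances[OF K P disj] by blast
  \<comment> \<open>One factor \<open>s\<close> each for the size of the polynomial, the variation of the distance, and the normalisation.\<close>
  define s where "s = root 3 t"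
  have s: "s > 1" "s ^ 3 = t" using t by (auto simp: s_def)
  have "\<exists>D. \<forall>y\<in>K. \<exists>f. degree f \<le> D \<and> Q y f"
  proof (rule compact_degree_bound[OF K])
    fix z0 assume z0: "z0 \<in> K"
    define \<rho> where "\<rho> = (s - 1) * d / 2"
    have \<rho>: "\<rho> > 0" "d + 2 * \<rho> = s * d" using s dR by (auto simp: \<rho>_def field_simps)
    obtain f where f: "poly f z0 = 1" "\<And>z. z \<in> K \<Longrightarrow> cmod (poly f z) \<le> 1 + (s - 1)"
      "\<And>z. z \<in> K \<Longrightarrow> dist z0 z \<ge> \<rho> \<Longrightarrow> cmod (poly f z) \<le> d / R"
      using peaking_polynomial[OF K z0, of \<rho> "d / R" "s - 1"] outer z0 s dR \<rho> by auto
    have "continuous (at z0) (\<lambda>z. poly f z)" by (intro continuous_intros)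
    moreover have "1 - 1 / s > 0" using s by simp
    ultimately obtain e where e: "e > 0" "\<And>z. dist z z0 < e \<Longrightarrow> dist (poly f z) 1 < 1 - 1/s"
      unfolding continuous_at_eps_delta using f(1) by metis
    show "\<exists>e>0. \<exists>D. \<forall>y\<in>K. dist z0 y < e \<longrightarrow> (\<exists>f. degree f \<le> D \<and> Q y f)"
    proof (intro exI[of _ "min e \<rho>"] conjI exI[of _ "degree f"] ballI impI)
      show "min e \<rho> > 0" using e \<rho> by simp
      fix y assume y: "y \<in> K" "dist z0 y < min e \<rho>"
      have "dist (poly f y) 1 < 1 - 1/s" using y e(2)[of y] by (simp add: dist_commute)
      then have fy: "cmod (poly f y) \<ge> 1/s"
        using norm_triangle_ineq2[of 1 "poly f y"] by (simp add: dist_norm norm_minus_commute)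
      moreover have "1/s > 0" using s by simp
      ultimately have fy0: "poly f y \<noteq> 0" by auto
      have fys: "1 \<le> s * cmod (poly f y)" using fy s by (simp add: divide_simps mult.commute split: if_splits)
      have main: "cmod (poly f z) * cmod (z - \<zeta>) \<le> s\<^sup>2 * cmod (y - \<zeta>)" if z: "z \<in> K" and \<zeta>: "\<zeta> \<in> P" for z \<zeta>
      proof (cases "dist z0 z < \<rho>")
        case True
        have "dist y z \<le> 2 * \<rho>" using True y dist_triangle3[of y z z0] by auto
        then have "cmod (z - \<zeta>) \<le> cmod (y - \<zeta>) + 2 * \<rho>"
          using norm_triangle_ineq[of "z - y" "y - \<zeta>"] by (simp add: dist_norm norm_minus_commute)
        also have "\<dots> = cmod (y - \<zeta>) + (s - 1) * d" by (simp add: \<rho>_def)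
        also have "\<dots> \<le> cmod (y - \<zeta>) + (s - 1) * cmod (y - \<zeta>)"
          using dR(3)[OF y(1) \<zeta>] s by (intro add_left_mono mult_left_mono) auto
        also have "\<dots> = s * cmod (y - \<zeta>)" by (simp add: algebra_simps)
        finally have "cmod (poly f z) * cmod (z - \<zeta>) \<le> s * (s * cmod (y - \<zeta>))"
          using f(2)[OF z] s by (intro mult_mono) auto
        then show ?thesis by (simp add: power2_eq_square algebra_simps)
      next
        case False
        then have "cmod (poly f z) * cmod (z - \<zeta>) \<le> d / R * R"
          using f(3)[OF z] dR(3)[OF z \<zeta>] dR(1,2) by (intro mult_mono) auto
        also have "\<dots> = 1 * d" using dR by simp
        also have "\<dots> \<le> s\<^sup>2 * cmod (y - \<zeta>)"
          using dR(1) dR(3)[OF y(1) \<zeta>] s by (intro mult_mono) (auto intro: less_imp_le)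
        finally show ?thesis .
      qed
      show "\<exists>g. degree g \<le> degree f \<and> Q y g"
      proof (intro exI[of _ "smult (1 / poly f y) f"] conjI)
        show "degree (smult (1 / poly f y) f) \<le> degree f" by simp
        show "Q y (smult (1 / poly f y) f)"
          unfolding Q_def
        proof (intro conjI ballI)
          show "poly (smult (1 / poly f y) f) y = 1" using fy0 by simp
          fix \<zeta> z assume "\<zeta> \<in> P" "z \<in> K"
          then have "cmod (poly f z) * cmod (z - \<zeta>) * 1 \<le> s\<^sup>2 * cmod (y - \<zeta>) * (s * cmod (poly f y))"
            using s by (intro mult_mono[OF main fys]) auto
          also have "\<dots> = t * cmod (y - \<zeta>) * cmod (poly f y)"
            by (simp add: s(2)[symmetric] power2_eq_square power3_eq_cube)
          finally show "cmod (poly (smult (1 / poly f y) f) z) * cmod (z - \<zeta>) \<le> t * cmod (y - \<zeta>)"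
            using fy0 by (simp add: norm_mult norm_divide divide_simps mult.commute)
        qed
      qed
    qed
  qed
  then show "\<exists>D. \<forall>z1\<in>K. \<forall>\<zeta>\<in>P. \<exists>f. degree f \<le> D \<and> poly f z1 = 1 \<and>
        (\<forall>z\<in>K. cmod (poly f z) * cmod (z - \<zeta>) \<le> t * cmod (z1 - \<zeta>))"
    unfolding Q_def by meson
qed

text \<open>A polynomial that is larger at \<open>\<zeta>\<close> than on \<open>K\<close>, raised to a power and normalised, gives \<open>u\<close> with
\<open>u(\<zeta>) = 1\<close> and \<open>|u| \<le> 1/2\<close> on \<open>K\<close>. Then \<open>1 - u = (z - \<zeta>) g\<close>, and \<open>1 / (z - \<zeta>) = g / (1 - u)\<close> with a
denominator that is invertible in the algebra.\<close>

lemma inverse_linear_off_hull: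
  assumes K: "compact K" and P: "\<zeta> \<notin> K" "\<zeta> \<notin> polynomial_hull K"
  shows "(\<lambda>z. 1 / (z - \<zeta>)) \<in> poly_uniform_limits K"
proof -
  obtain p where p: "cmod (poly p \<zeta>) > sup_norm K (poly p)"
    using P(2) by (auto simp: polynomial_hull_def not_le)
  have "compact ((\<lambda>z. cmod (poly p z)) ` K)"
    using K by (intro compact_continuous_image continuous_intros)
  then have "bdd_above ((\<lambda>z. cmod (poly p z)) ` K)"
    by (intro bounded_imp_bdd_above compact_imp_bounded)
  then have le: "cmod (poly p z) \<le> sup_norm K (poly p)" if "z \<in> K" for z
    unfolding sup_norm_def using that by (intro cSUP_upper)
  show ?thesis
  proof (cases "K = {}")
    case False
    then have "sup_norm K (poly p) \<ge> 0" using le norm_ge_zero order_trans by blast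
    then have p0: "poly p \<zeta> \<noteq> 0" using p by auto
    define a where "a = sup_norm K (poly p) / cmod (poly p \<zeta>)"
    have a: "0 \<le> a" "a < 1" using p \<open>sup_norm K (poly p) \<ge> 0\<close> by (auto simp: a_def divide_simps)
    obtain n where n: "a ^ n < 1/2" using real_arch_pow_inv[OF _ a(2), of "1/2"] by auto
    define u where "u = smult (1 / poly p \<zeta> ^ n) (p ^ n)"
    have u1: "poly u \<zeta> = 1" using p0 by (simp add: u_def)
    have ule: "cmod (poly u z) \<le> 1/2" if "z \<in> K" for z
    proof -
      have "cmod (poly u z) = (cmod (poly p z) / cmod (poly p \<zeta>)) ^ n"
        by (simp add: u_def norm_mult norm_divide norm_power power_divide)
      also have "\<dots> \<le> a ^ n"
        unfolding a_def using le[OF that] p0 by (intro power_mono divide_right_mono) auto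
      finally show ?thesis using n by simp
    qed
    have "[:-\<zeta>, 1:] dvd (1 - u)" using u1 by (simp add: poly_eq_0_iff_dvd[symmetric])
    then obtain g where g: "1 - u = [:-\<zeta>, 1:] * g" by (auto elim: dvdE)
    have inv: "(\<lambda>z. 1 / poly (1 - u) z) \<in> poly_uniform_limits K"
      by (rule poly_uniform_limits_inverse_perturb[OF K poly_uniform_limits_const[of 1]
            poly_uniform_limits_poly[of "1 - u"]]) (use ule in auto)
    from poly_uniform_limits_mult[OF K poly_uniform_limits_poly[of g] inv]
    show ?thesis
    proof (rule poly_uniform_limits_cong)
      fix z assume z: "z \<in> K"
      have "poly (1 - u) z = (z - \<zeta>) * poly g z" unfolding g by (simp add: algebra_simps)
      moreover have "poly (1 - u) z \<noteq> 0" using ule[OF z] by auto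
      ultimately show "poly g z * (1 / poly (1 - u) z) = 1 / (z - \<zeta>)" by simp
    qed
  qed (auto simp: poly_uniform_limits_iff)
qed

text \<open>Off the hull the function \<open>1 / (z - \<zeta>)\<close> is uniformly approximated on \<open>K\<close> by polynomials, so one
polynomial works for all \<open>z1\<close> and, by continuity, for all poles near \<open>\<zeta>\<close>.\<close>

lemma poles_absorbed_off_hull:
  assumes K: "compact K" and P: "compact P" and disj: "K \<inter> P = {}"
    and hull: "polynomial_hull K \<inter> P = {}"
  shows "poles_absorbed K P"
  unfolding poles_absorbed_def
proof (intro allI impI)
  fix t :: real assume t: "t > 1"
  \<comment> \<open>The solution of \<open>(1 + \<eta>) / (1 - \<eta>) = t\<close>.\<close>
  define \<eta> where "\<eta> = (t - 1) / (t + 1)"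
  have \<eta>: "0 < \<eta>" "\<eta> < 1" "1 + \<eta> = t * (1 - \<eta>)" using t by (auto simp: \<eta>_def field_simps)
  define Q where "Q = (\<lambda>\<zeta> f. \<forall>z\<in>K. cmod (poly f z * (z - \<zeta>) - 1) \<le> \<eta>)"
  obtain d R where dR: "0 < d" "d \<le> R"
    "\<And>z \<zeta>. z \<in> K \<Longrightarrow> \<zeta> \<in> P \<Longrightarrow> d \<le> cmod (z - \<zeta>) \<and> cmod (z - \<zeta>) \<le> R"
    using disjoint_compact_distances[OF K P disj] by blast
  have "\<exists>D. \<forall>\<zeta>\<in>P. \<exists>f. degree f \<le> D \<and> Q \<zeta> f"
  proof (rule compact_degree_bound[OF P])
    fix \<zeta>0 assume \<zeta>0: "\<zeta>0 \<in> P"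
    have "(\<lambda>z. 1 / (z - \<zeta>0)) \<in> poly_uniform_limits K"
      using inverse_linear_off_hull[OF K] \<zeta>0 disj hull by blast
    moreover have "\<eta> / (2 * R) > 0" using \<eta> dR by simp
    ultimately obtain f where f: "\<And>z. z \<in> K \<Longrightarrow> cmod (poly f z - 1 / (z - \<zeta>0)) < \<eta> / (2 * R)"
      unfolding poly_uniform_limits_iff by meson
    have near: "cmod (poly f z * (z - \<zeta>0) - 1) \<le> \<eta> / 2" if z: "z \<in> K" for z
    proof -
      have "z \<noteq> \<zeta>0" using z \<zeta>0 disj by auto
      then have "cmod (poly f z * (z - \<zeta>0) - 1) = cmod (poly f z - 1 / (z - \<zeta>0)) * cmod (z - \<zeta>0)"
        by (simp flip: norm_mult add: algebra_simps)
      also have "\<dots> \<le> \<eta> / (2 * R) * R"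
        using f[OF z] dR(1,2) dR(3)[OF z \<zeta>0] \<eta> by (intro mult_mono) auto
      finally show ?thesis using dR by simp
    qed
    obtain M where M: "M > 0" "\<And>z. z \<in> K \<Longrightarrow> cmod (poly f z) \<le> M"
      using poly_uniform_limits_bounded[OF K poly_uniform_limits_poly[of f]] unfolding bounded_pos by auto
    have "Q \<zeta> f" if \<zeta>: "\<zeta> \<in> P" "dist \<zeta>0 \<zeta> < \<eta> / (2 * M)" for \<zeta>
      unfolding Q_def
    proof
      fix z assume z: "z \<in> K"
      have "cmod (poly f z) * cmod (\<zeta>0 - \<zeta>) \<le> M * (\<eta> / (2 * M))"
        using M(2)[OF z] M(1) \<zeta>(2) by (intro mult_mono) (auto simp: dist_norm)
      then have "cmod (poly f z * (\<zeta>0 - \<zeta>)) \<le> \<eta> / 2" using M(1) by (simp add: norm_mult)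
      moreover have eq: "poly f z * (z - \<zeta>) - 1 = (poly f z * (z - \<zeta>0) - 1) + poly f z * (\<zeta>0 - \<zeta>)"
        by (simp add: algebra_simps)
      ultimately show "cmod (poly f z * (z - \<zeta>) - 1) \<le> \<eta>"
        unfolding eq using near[OF z] by (intro norm_triangle_le) linarith
    qed
    moreover have "\<eta> / (2 * M) > 0" using \<eta> M by simp
    ultimately show "\<exists>e>0. \<exists>D. \<forall>y\<in>P. dist \<zeta>0 y < e \<longrightarrow> (\<exists>f. degree f \<le> D \<and> Q y f)"
      by blast
  qed
  then obtain D where D: "\<And>\<zeta>. \<zeta> \<in> P \<Longrightarrow> \<exists>f. degree f \<le> D \<and> Q \<zeta> f" by blast
  show "\<exists>D. \<forall>z1\<in>K. \<forall>\<zeta>\<in>P. \<exists>f. degree f \<le> D \<and> poly f z1 = 1 \<and>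
        (\<forall>z\<in>K. cmod (poly f z) * cmod (z - \<zeta>) \<le> t * cmod (z1 - \<zeta>))"
  proof (intro exI[of _ D] ballI)
    fix z1 \<zeta> assume z1: "z1 \<in> K" and \<zeta>: "\<zeta> \<in> P"
    obtain f where f: "degree f \<le> D" "\<And>z. z \<in> K \<Longrightarrow> cmod (poly f z * (z - \<zeta>) - 1) \<le> \<eta>"
      using D[OF \<zeta>] unfolding Q_def by blast
    have lower: "cmod (poly f z1) * cmod (z1 - \<zeta>) \<ge> 1 - \<eta>"
      using f(2)[OF z1] norm_triangle_ineq2[of 1 "poly f z1 * (z1 - \<zeta>)"]
      by (simp add: norm_mult norm_minus_commute)
    then have f0: "poly f z1 \<noteq> 0" using \<eta> by auto
    show "\<exists>f. degree f \<le> D \<and> poly f z1 = 1 \<and>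
        (\<forall>z\<in>K. cmod (poly f z) * cmod (z - \<zeta>) \<le> t * cmod (z1 - \<zeta>))"
    proof (intro exI[of _ "smult (1 / poly f z1) f"] conjI ballI)
      show "degree (smult (1 / poly f z1) f) \<le> D" using f(1) by simp
      show "poly (smult (1 / poly f z1) f) z1 = 1" using f0 by simp
      fix z assume z: "z \<in> K"
      have "cmod (poly f z) * cmod (z - \<zeta>) \<le> 1 + \<eta>"
        using f(2)[OF z] norm_triangle_ineq2[of "poly f z * (z - \<zeta>)" 1] by (simp add: norm_mult)
      also have "\<dots> \<le> t * (cmod (poly f z1) * cmod (z1 - \<zeta>))"
        unfolding \<eta>(3) using lower t by (intro mult_left_mono) auto
      finally show "cmod (poly (smult (1 / poly f z1) f) z) * cmod (z - \<zeta>) \<le> t * cmod (z1 - \<zeta>)"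
        using f0 by (simp add: norm_mult norm_divide divide_simps mult_ac)
    qed
  qed
qed

text \<open>Multiplying the polynomials for the individual zeros of \<open>q\<close>.\<close>

lemma poles_absorbed_divisor:
  assumes "poles_absorbed K P" "t > 1"
  obtains D where "\<And>z1 q. z1 \<in> K \<Longrightarrow> q \<noteq> 0 \<Longrightarrow> {z. poly q z = 0} \<subseteq> P \<Longrightarrow>
     \<exists>G. degree G \<le> D * degree q \<and> poly G z1 = 1 \<and>
        (\<forall>z\<in>K. cmod (poly G z) * cmod (poly q z) \<le> t ^ degree q * cmod (poly q z1))"
proof -
  obtain D where D: "\<And>z1 \<zeta>. z1 \<in> K \<Longrightarrow> \<zeta> \<in> P \<Longrightarrow> \<exists>f. degree f \<le> D \<and> poly f z1 = 1 \<and>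
        (\<forall>z\<in>K. cmod (poly f z) * cmod (z - \<zeta>) \<le> t * cmod (z1 - \<zeta>))"
    using assms unfolding poles_absorbed_def by metis
  have "\<exists>G. degree G \<le> D * degree q \<and> poly G z1 = 1 \<and>
        (\<forall>z\<in>K. cmod (poly G z) * cmod (poly q z) \<le> t ^ degree q * cmod (poly q z1))"
    if "z1 \<in> K" "q \<noteq> 0" "{z. poly q z = 0} \<subseteq> P" for z1 q
    using that(2,3)
  proof (induction "degree q" arbitrary: q)
    case 0
    then obtain c where "q = [:c:]" by (metis degree_eq_zeroE)
    then show ?case by (intro exI[of _ 1]) auto
  next
    case (Suc n)
    then have "\<not> constant (poly q)" by (simp add: constant_degree)
    then obtain \<zeta> where \<zeta>: "poly q \<zeta> = 0" using fundamental_theorem_of_algebra by blast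
    then obtain r where r: "q = [:-\<zeta>, 1:] * r" by (auto simp: poly_eq_0_iff_dvd elim: dvdE)
    with Suc.prems have r0: "r \<noteq> 0" by auto
    then have deg: "degree q = Suc (degree r)" unfolding r by (subst degree_mult_eq) auto
    have "{z. poly r z = 0} \<subseteq> P" using Suc.prems(2) by (auto simp: r)
    with Suc.hyps(1)[of r] Suc.hyps(2) deg r0 obtain G where G: "degree G \<le> D * degree r" "poly G z1 = 1"
      "\<And>z. z \<in> K \<Longrightarrow> cmod (poly G z) * cmod (poly r z) \<le> t ^ degree r * cmod (poly r z1)"
      by auto
    have "\<zeta> \<in> P" using \<zeta> Suc.prems(2) by auto
    from D[OF \<open>z1 \<in> K\<close> this] obtain f where f: "degree f \<le> D" "poly f z1 = 1"
      "\<And>z. z \<in> K \<Longrightarrow> cmod (poly f z) * cmod (z - \<zeta>) \<le> t * cmod (z1 - \<zeta>)" by blast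
    show ?case
    proof (intro exI[of _ "f * G"] conjI ballI)
      show "degree (f * G) \<le> D * degree q"
        using degree_mult_le[of f G] f(1) G(1) deg by simp
      show "poly (f * G) z1 = 1" using f G by simp
      fix z assume z: "z \<in> K"
      have "(cmod (poly f z) * cmod (z - \<zeta>)) * (cmod (poly G z) * cmod (poly r z))
          \<le> (t * cmod (z1 - \<zeta>)) * (t ^ degree r * cmod (poly r z1))"
        using assms(2) by (intro mult_mono[OF f(3)[OF z] G(3)[OF z]]) auto
      moreover have "cmod (poly q w) = cmod (w - \<zeta>) * cmod (poly r w)" for w
        unfolding r poly_mult norm_mult by simp
      ultimately show "cmod (poly (f * G) z) * cmod (poly q z) \<le> t ^ degree q * cmod (poly q z1)"
        unfolding deg by (simp add: norm_mult mult_ac)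
    qed
  qed
  then show ?thesis by (rule that)
qed

section \<open>Norm comparison for rational functions\<close>

lemma continuous_imp_L2_integrable:
  assumes K: "compact K" and \<mu>: "\<mu> \<in> positive_measures K" and g: "continuous_on K g"
  shows "set_integrable \<mu> K (\<lambda>z. (cmod (g z))\<^sup>2)"
proof -
  interpret finite_measure \<mu> using \<mu> by (simp add: positive_measures_def)
  have sets: "sets \<mu> = sets borel" using \<mu> by (simp add: positive_measures_def)
  have cont: "continuous_on K (\<lambda>z. (cmod (g z))\<^sup>2)" by (intro continuous_intros g)
  then have "compact ((\<lambda>z. (cmod (g z))\<^sup>2) ` K)" using K by (rule compact_continuous_image)
  from compact_imp_bounded[OF this]
  obtain B where B: "B > 0" "\<And>z. z \<in> K \<Longrightarrow> norm ((cmod (g z))\<^sup>2) \<le> B"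
    unfolding bounded_pos by auto
  have "(\<lambda>z. indicator K z *\<^sub>R (cmod (g z))\<^sup>2) \<in> borel_measurable borel"
    by (intro borel_measurable_continuous_on_indicator borel_compact K cont)
  then have "(\<lambda>z. indicator K z *\<^sub>R (cmod (g z))\<^sup>2) \<in> borel_measurable \<mu>"
    by (subst measurable_cong_sets[OF sets refl])
  then show ?thesis
    unfolding set_integrable_def
    by (intro integrable_const_bound[of _ B]) (use B in \<open>auto simp: indicator_def\<close>)
qed

lemma L2_norm_on_nonneg: "L2_norm_on K \<mu> g \<ge> 0"
  unfolding L2_norm_on_def set_lebesgue_integral_def
  by (intro real_sqrt_ge_zero integral_nonneg_AE) auto

lemma L2_norm_on_le_scaled:
  assumes K: "compact K" and \<mu>: "\<mu> \<in> positive_measures K"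
    and cont: "continuous_on K g" "continuous_on K h"
    and c: "c \<ge> 0" "\<And>z. z \<in> K \<Longrightarrow> cmod (g z) \<le> c * cmod (h z)"
  shows "L2_norm_on K \<mu> g \<le> c * L2_norm_on K \<mu> h"
proof -
  have "(LINT z:K|\<mu>. (cmod (g z))\<^sup>2) \<le> (LINT z:K|\<mu>. c\<^sup>2 * (cmod (h z))\<^sup>2)"
  proof (rule set_integral_mono)
    show "set_integrable \<mu> K (\<lambda>z. (cmod (g z))\<^sup>2)"
      by (rule continuous_imp_L2_integrable[OF K \<mu> cont(1)])
    show "set_integrable \<mu> K (\<lambda>z. c\<^sup>2 * (cmod (h z))\<^sup>2)"
      by (rule set_integrable_mult_right[OF continuous_imp_L2_integrable[OF K \<mu> cont(2)]])
    show "(cmod (g z))\<^sup>2 \<le> c\<^sup>2 * (cmod (h z))\<^sup>2" if "z \<in> K" for z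
      using power_mono[OF c(2)[OF that], of 2] by (simp add: power_mult_distrib)
  qed
  also have "\<dots> = c\<^sup>2 * (LINT z:K|\<mu>. (cmod (h z))\<^sup>2)" by simp
  finally have "sqrt (LINT z:K|\<mu>. (cmod (g z))\<^sup>2) \<le> sqrt (c\<^sup>2 * (LINT z:K|\<mu>. (cmod (h z))\<^sup>2))"
    by (rule real_sqrt_le_mono)
  also have "\<dots> = c * sqrt (LINT z:K|\<mu>. (cmod (h z))\<^sup>2)"
    unfolding real_sqrt_mult using c(1) by simp
  finally show ?thesis unfolding L2_norm_on_def .
qed

lemma le_sup_norm:
  assumes "compact K" "continuous_on K g" "z \<in> K"
  shows "cmod (g z) \<le> sup_norm K g"
proof -
  have "compact ((\<lambda>z. cmod (g z)) ` K)"
    using assms by (intro compact_continuous_image continuous_intros)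
  then have "bdd_above ((\<lambda>z. cmod (g z)) ` K)"
    by (intro bounded_imp_bdd_above compact_imp_bounded)
  then show ?thesis unfolding sup_norm_def using assms(3) by (intro cSUP_upper)
qed

lemma sup_norm_le:
  assumes "K \<noteq> {}" "\<And>z. z \<in> K \<Longrightarrow> cmod (g z) \<le> c"
  shows "sup_norm K g \<le> c"
  unfolding sup_norm_def by (rule cSUP_least) (use assms in auto)

lemma limsup_norm_ratio_le_1I:
  assumes "\<And>t. t > 1 \<Longrightarrow> eventually (\<lambda>k. sup_norm K (g k) \<le> t ^ k * L2_norm_on K \<mu> (g k)) sequentially"
  shows "limsup_norm_ratio_le_1 K \<mu> g"
  unfolding limsup_norm_ratio_le_1_def
proof (rule dense_ge)
  fix y :: ereal assume y: "1 < y"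
  show "limsup (\<lambda>k. ratio_root k (sup_norm K (g k)) (L2_norm_on K \<mu> (g k))) \<le> y"
  proof (cases y)
    case (real t)
    with y have t: "t > 1" by simp
    have "eventually (\<lambda>k. ratio_root k (sup_norm K (g k)) (L2_norm_on K \<mu> (g k)) \<le> ereal t) sequentially"
      using assms[OF t] eventually_gt_at_top[of 0]
    proof eventually_elim
      case (elim k)
      define a where "a = sup_norm K (g k)"
      define b where "b = L2_norm_on K \<mu> (g k)"
      have ab: "a \<le> t ^ k * b" "b \<ge> 0" using elim by (auto simp: a_def b_def L2_norm_on_nonneg)
      have "ratio_root k a b \<le> ereal t"
      proof (cases "b = 0")
        case True
        then show ?thesis using ab t by (simp add: ratio_root_def)
      next
        case False
        then have "a / b \<le> t ^ k" using ab by (simp add: divide_simps)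
        then have "root k (a / b) \<le> root k (t ^ k)" using elim by simp
        also have "\<dots> = t" using t elim by (simp add: real_root_power_cancel)
        finally show ?thesis using False by (simp add: ratio_root_def)
      qed
      then show ?case by (simp add: a_def b_def)
    qed
    then show ?thesis unfolding real by (rule Limsup_bounded)
  qed (use y in auto)
qed

text \<open>The limit superior along all sequences is a uniform estimate in disguise: if it failed for
infinitely many \<open>k\<close>, the failing polynomials, filled up with the constant \<open>1\<close> at the other
indices, would form a sequence that violates the property.\<close>

lemma Bernstein_Markov_uniform:
  assumes K: "compact K" "K \<noteq> {}" and BM: "Bernstein_Markov K \<mu>" and t: "t > 1"
  shows "eventually (\<lambda>k. \<forall>p. degree p \<le> k \<longrightarrow>
           sup_norm K (poly p) \<le> t ^ k * L2_norm_on K \<mu> (poly p)) sequentially"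
proof -
  define good where "good = (\<lambda>k p. degree p \<le> k \<longrightarrow> sup_norm K (poly p) \<le> t ^ k * L2_norm_on K \<mu> (poly p))"
  define p where "p = (\<lambda>k. if \<forall>p. good k p then 1 else (SOME p. \<not> good k p))"
  have bad: "\<not> good k (p k)" if "\<not> (\<forall>p. good k p)" for k
    using that someI_ex[of "\<lambda>p. \<not> good k p"] unfolding p_def by auto
  have deg: "degree (p k) \<le> k" for k
    using bad[of k] by (cases "\<forall>p. good k p") (auto simp: p_def good_def)
  have pos: "sup_norm K (poly (p k)) > 0" if "\<not> (\<forall>p. good k p)" for k
  proof -
    have "t ^ k * L2_norm_on K \<mu> (poly (p k)) < sup_norm K (poly (p k))"
      using bad[OF that] by (auto simp: good_def)
    moreover have "0 \<le> t ^ k * L2_norm_on K \<mu> (poly (p k))"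
      using t L2_norm_on_nonneg by (intro mult_nonneg_nonneg) auto
    ultimately show ?thesis by linarith
  qed
  have "nonvanishing_seq K (\<lambda>k. poly (p k))"
    unfolding nonvanishing_seq_def
  proof
    fix k
    show "\<exists>z\<in>K. poly (p k) z \<noteq> 0"
    proof (cases "\<forall>p. good k p")
      case True
      then show ?thesis using K by (auto simp: p_def)
    next
      case False
      show ?thesis
      proof (rule ccontr)
        assume "\<not> ?thesis"
        then have "sup_norm K (poly (p k)) \<le> 0" using K by (intro sup_norm_le) auto
        with pos[OF False] show False by simp
      qed
    qed
  qed
  with BM deg have "limsup_norm_ratio_le_1 K \<mu> (\<lambda>k. poly (p k))"
    unfolding Bernstein_Markov_def by blast
  then have "limsup (\<lambda>k. ratio_root k (sup_norm K (poly (p k))) (L2_norm_on K \<mu> (poly (p k)))) < ereal t"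
    unfolding limsup_norm_ratio_le_1_def by (rule le_less_trans) (use t in simp)
  from Limsup_lessD[OF this] show ?thesis
    using eventually_gt_at_top[of 0]
  proof eventually_elim
    case (elim k)
    have "\<forall>p. good k p"
    proof (rule ccontr)
      assume nall: "\<not> (\<forall>p. good k p)"
      define a where "a = sup_norm K (poly (p k))"
      define b where "b = L2_norm_on K \<mu> (poly (p k))"
      have ab: "a > t ^ k * b" "b \<ge> 0" "a > 0" "ratio_root k a b < ereal t"
        using bad[OF nall] pos[OF nall] elim by (auto simp: good_def a_def b_def L2_norm_on_nonneg)
      then have "b > 0" by (auto simp: ratio_root_def split: if_splits)
      then have "root k (a / b) < t" using ab by (simp add: ratio_root_def)
      then have "root k (a / b) ^ k < t ^ k"
        using elim ab \<open>b > 0\<close> by (intro power_strict_mono) auto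
      then have "a / b < t ^ k" using elim ab \<open>b > 0\<close> by simp
      then show False using ab \<open>b > 0\<close> by (simp add: divide_simps)
    qed
    then show ?case by (simp add: good_def)
  qed
qed

text \<open>Fix \<open>z1 \<in> K\<close> and let \<open>G\<close> absorb the zeros of \<open>q\<close> with respect to \<open>z1\<close>. Then \<open>p G\<close> is a polynomial of
degree at most \<open>(1 + D S) k\<close> that agrees with \<open>p\<close> at \<open>z1\<close> and is bounded on \<open>K\<close> by
\<open>s\<^bsup>deg q\<^esup> |q(z1)| |p / q|\<close>. The uniform estimate for \<open>p G\<close> therefore bounds \<open>|p(z1)| / |q(z1)|\<close> by the
\<open>L\<^sup>2\<close> norm of \<open>p / q\<close>. The degree grows only by the constant factor \<open>1 + D S\<close>, which is harmless
because the base \<open>u\<close> of that estimate is chosen after \<open>D\<close>.\<close>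

lemma rational_norm_comparison:
  fixes S :: nat
  assumes K: "compact K" "K \<noteq> {}" and \<mu>: "\<mu> \<in> positive_measures K" and BM: "Bernstein_Markov K \<mu>"
    and disj: "K \<inter> P = {}" and abs: "poles_absorbed K P" and t: "t > 1"
  shows "eventually (\<lambda>k. \<forall>p q. degree p \<le> k \<and> degree q \<le> S * k \<and> q \<noteq> 0 \<and> {z. poly q z = 0} \<subseteq> P \<longrightarrow>
     sup_norm K (\<lambda>z. poly p z / poly q z) \<le> t ^ k * L2_norm_on K \<mu> (\<lambda>z. poly p z / poly q z)) sequentially"
proof -
  define s where "s = root (S + 1) t"
  have "s > 1" unfolding s_def using t by simp
  moreover have "s ^ (S + 1) = t"
    unfolding s_def by (rule real_root_pow_pos2) (use t in simp_all)
  ultimately have s: "s > 1" "s ^ (S + 1) = t" .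
  obtain D where D: "\<And>z1 q. z1 \<in> K \<Longrightarrow> q \<noteq> 0 \<Longrightarrow> {z. poly q z = 0} \<subseteq> P \<Longrightarrow>
     \<exists>G. degree G \<le> D * degree q \<and> poly G z1 = 1 \<and>
        (\<forall>z\<in>K. cmod (poly G z) * cmod (poly q z) \<le> s ^ degree q * cmod (poly q z1))"
    by (rule poles_absorbed_divisor[OF abs s(1)]) (rule that)
  define m where "m = 1 + D * S"
  define u where "u = root m s"
  have "m > 0" by (simp add: m_def)
  then have u: "u > 1" "u ^ m = s"
    unfolding u_def using s(1) by (simp_all add: real_root_pow_pos2)
  obtain N where N: "\<And>k p. k \<ge> N \<Longrightarrow> degree p \<le> k \<Longrightarrow>
      sup_norm K (poly p) \<le> u ^ k * L2_norm_on K \<mu> (poly p)"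
    using Bernstein_Markov_uniform[OF K BM u(1)] unfolding eventually_sequentially by blast
  show ?thesis
    unfolding eventually_sequentially
  proof (intro exI[of _ N] allI impI)
    fix k and p q :: "complex poly"
    assume k: "k \<ge> N" and pq: "degree p \<le> k \<and> degree q \<le> S * k \<and> q \<noteq> 0 \<and> {z. poly q z = 0} \<subseteq> P"
    define L where "L = L2_norm_on K \<mu> (\<lambda>z. poly p z / poly q z)"
    have q0: "poly q z \<noteq> 0" if "z \<in> K" for z using that pq disj by auto
    have contpq: "continuous_on K (\<lambda>z. poly p z / poly q z)"
      using q0 by (intro continuous_intros) auto
    show "sup_norm K (\<lambda>z. poly p z / poly q z) \<le> t ^ k * L2_norm_on K \<mu> (\<lambda>z. poly p z / poly q z)"
    proof (rule sup_norm_le[OF K(2)])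
      fix z1 assume z1: "z1 \<in> K"
      obtain G where G: "degree G \<le> D * degree q" "poly G z1 = 1"
        "\<And>z. z \<in> K \<Longrightarrow> cmod (poly G z) * cmod (poly q z) \<le> s ^ degree q * cmod (poly q z1)"
        using D[OF z1] pq by blast
      have contpG: "continuous_on K (poly (p * G))"
        by (rule poly_uniform_limits_continuous) simp
      have "degree (p * G) \<le> k + D * (S * k)"
        using degree_mult_le[of p G] G(1) pq mult_le_mono2[of "degree q" "S * k" D] by linarith
      then have deg: "degree (p * G) \<le> m * k" by (simp add: m_def algebra_simps)
      have "k \<le> m * k" by (simp add: m_def)
      then have "N \<le> m * k" using k by linarith
      have "cmod (poly p z1) = cmod (poly (p * G) z1)" using G(2) by simp
      also have "\<dots> \<le> sup_norm K (poly (p * G))" by (rule le_sup_norm[OF K(1) contpG z1])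
      also have "\<dots> \<le> u ^ (m * k) * L2_norm_on K \<mu> (poly (p * G))" by (rule N) fact+
      also have "u ^ (m * k) = s ^ k" using u by (simp add: power_mult)
      also have "L2_norm_on K \<mu> (poly (p * G)) \<le> (s ^ degree q * cmod (poly q z1)) * L"
        unfolding L_def
      proof (rule L2_norm_on_le_scaled[OF K(1) \<mu> contpG contpq])
        show "s ^ degree q * cmod (poly q z1) \<ge> 0" using s by simp
        fix z assume z: "z \<in> K"
        have "cmod (poly (p * G) z) = cmod (poly p z / poly q z) * (cmod (poly G z) * cmod (poly q z))"
          using q0[OF z] by (simp add: norm_mult norm_divide)
        also have "\<dots> \<le> cmod (poly p z / poly q z) * (s ^ degree q * cmod (poly q z1))"
          by (intro mult_left_mono G(3) z) auto
        finally show "cmod (poly (p * G) z) \<le> s ^ degree q * cmod (poly q z1) * cmod (poly p z / poly q z)"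
          by (simp add: mult.commute)
      qed
      also have "\<dots> \<le> (s ^ (S * k) * cmod (poly q z1)) * L"
        using s pq L2_norm_on_nonneg[of K \<mu>] unfolding L_def
        by (intro mult_right_mono power_increasing) auto
      finally have "cmod (poly p z1) \<le> s ^ k * ((s ^ (S * k) * cmod (poly q z1)) * L)"
        using s by (simp add: mult_left_mono)
      also have "\<dots> = (s ^ (S + 1)) ^ k * L * cmod (poly q z1)"
        by (simp add: power_mult power_mult_distrib power_add mult_ac flip: power_mult)
      finally show "cmod (poly p z1 / poly q z1) \<le> t ^ k * L2_norm_on K \<mu> (\<lambda>z. poly p z / poly q z)"
        unfolding s(2) using q0[OF z1] by (simp add: norm_divide divide_simps L_def)
    qed
  qed
qed

section \<open>Discretisation of logarithmic potentials\<close>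

text \<open>The complement of the support is covered by open null sets; countably many of them suffice.\<close>

lemma positive_measures_AE:
  assumes "\<sigma> \<in> positive_measures P"
  shows "AE x in \<sigma>. x \<in> P"
proof -
  have sets: "sets \<sigma> = sets borel" and supp: "measure_support \<sigma> \<subseteq> P"
    using assms by (auto simp: positive_measures_def)
  define F where "F = {U. open U \<and> emeasure \<sigma> U = 0}"
  obtain F' where F': "F' \<subseteq> F" "countable F'" "\<Union>F' = \<Union>F"
    using Lindelof[of F] by (auto simp: F_def)
  have "(\<Union>U\<in>F'. U) \<in> null_sets \<sigma>"
  proof (rule null_sets_UN')
    show "U \<in> null_sets \<sigma>" if "U \<in> F'" for U
      using that F'(1) sets by (auto simp: F_def null_sets_def)
  qed (rule F'(2))
  moreover have "- P \<subseteq> \<Union>F"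
  proof
    fix x assume "x \<in> - P"
    then have "x \<notin> measure_support \<sigma>" using supp by auto
    then obtain U where "open U" "x \<in> U" "emeasure \<sigma> U = 0"
      unfolding measure_support_def by auto
    then show "x \<in> \<Union>F" by (auto simp: F_def)
  qed
  ultimately show ?thesis using F'(3) by (intro AE_I'[of "\<Union>F"]) auto
qed

lemma abs_ln_diff_le:
  fixes a b d :: real
  assumes "0 < d" "d \<le> a" "d \<le> b"
  shows "\<bar>ln a - ln b\<bar> \<le> \<bar>a - b\<bar> / d"
proof -
  have *: "ln x - ln y \<le> \<bar>x - y\<bar> / d" if "d \<le> x" "d \<le> y" for x y
  proof -
    have "ln x - ln y \<le> (x - y) / y" using that assms(1) by (intro ln_diff_le) auto
    also have "\<dots> \<le> \<bar>x - y\<bar> / y" using that assms(1) by (intro divide_right_mono) auto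
    also have "\<dots> \<le> \<bar>x - y\<bar> / d" using that assms(1) by (intro divide_left_mono) auto
    finally show ?thesis .
  qed
  show ?thesis using *[of a b] *[of b a] assms by (auto simp: abs_if split: if_splits)
qed

lemma abs_ln_le_max:
  fixes d x R :: real
  assumes "0 < d" "d \<le> x" "x \<le> R"
  shows "\<bar>ln x\<bar> \<le> max \<bar>ln d\<bar> \<bar>ln R\<bar>"
proof -
  have "0 < x" "0 < R" using assms by auto
  then have "ln d \<le> ln x" "ln x \<le> ln R" using assms by simp_all
  then show ?thesis by auto
qed

lemma ln_distance_integrable:
  assumes \<sigma>: "\<sigma> \<in> positive_measures P" and d: "0 < d" "\<And>\<zeta>. \<zeta> \<in> P \<Longrightarrow> d \<le> cmod (z - \<zeta>) \<and> cmod (z - \<zeta>) \<le> R"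
  shows "integrable \<sigma> (\<lambda>\<zeta>. ln (cmod (z - \<zeta>)))"
proof -
  interpret finite_measure \<sigma> using \<sigma> by (simp add: positive_measures_def)
  have sets: "sets \<sigma> = sets borel" using \<sigma> by (simp add: positive_measures_def)
  have "(\<lambda>\<zeta>. ln (cmod (z - \<zeta>))) \<in> borel_measurable borel" by measurable
  then have meas: "(\<lambda>\<zeta>. ln (cmod (z - \<zeta>))) \<in> borel_measurable \<sigma>"
    by (subst measurable_cong_sets[OF sets refl])
  have "norm (ln (cmod (z - \<zeta>))) \<le> max \<bar>ln d\<bar> \<bar>ln R\<bar>" if "\<zeta> \<in> P" for \<zeta>
    using abs_ln_le_max[OF d(1)] d(2)[OF that] by simp
  then show ?thesis
    using positive_measures_AE[OF \<sigma>] by (intro integrable_const_bound meas) auto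
qed

lemma log_potential_continuous_on:
  assumes K: "compact K" and P: "compact P" and disj: "K \<inter> P = {}" and \<sigma>: "\<sigma> \<in> positive_measures P"
  shows "continuous_on K (log_potential \<sigma>)"
proof -
  interpret finite_measure \<sigma> using \<sigma> by (simp add: positive_measures_def)
  obtain d R where dR: "0 < d" "d \<le> R"
    "\<And>z \<zeta>. z \<in> K \<Longrightarrow> \<zeta> \<in> P \<Longrightarrow> d \<le> cmod (z - \<zeta>) \<and> cmod (z - \<zeta>) \<le> R"
    using disjoint_compact_distances[OF K P disj] by blast
  have int: "integrable \<sigma> (\<lambda>\<zeta>. ln (cmod (z - \<zeta>)))" if "z \<in> K" for z
    by (rule ln_distance_integrable[OF \<sigma> dR(1), of z R]) (use dR(3) that in auto)
  define M where "M = measure \<sigma> (space \<sigma>)"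
  have lip: "dist (log_potential \<sigma> z) (log_potential \<sigma> y) \<le> (M / d) * dist z y" if "z \<in> K" "y \<in> K" for z y
  proof -
    have "log_potential \<sigma> z - log_potential \<sigma> y = (LINT \<zeta>|\<sigma>. ln (cmod (y - \<zeta>)) - ln (cmod (z - \<zeta>)))"
      using int that by (simp add: log_potential_def)
    also have "norm \<dots> \<le> (LINT \<zeta>|\<sigma>. norm (ln (cmod (y - \<zeta>)) - ln (cmod (z - \<zeta>))))"
      by (rule integral_norm_bound)
    also have "\<dots> \<le> (LINT \<zeta>|\<sigma>. dist z y / d)"
    proof (rule integral_mono_AE)
      show "AE \<zeta> in \<sigma>. norm (ln (cmod (y - \<zeta>)) - ln (cmod (z - \<zeta>))) \<le> dist z y / d"
        using positive_measures_AE[OF \<sigma>]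
      proof eventually_elim
        case (elim \<zeta>)
        have "\<bar>ln (cmod (y - \<zeta>)) - ln (cmod (z - \<zeta>))\<bar> \<le> \<bar>cmod (y - \<zeta>) - cmod (z - \<zeta>)\<bar> / d"
          using dR(1) dR(3)[OF _ elim] that by (intro abs_ln_diff_le) auto
        also have "\<dots> \<le> dist z y / d"
          using dR(1) norm_triangle_ineq3[of "y - \<zeta>" "z - \<zeta>"]
          by (intro divide_right_mono) (auto simp: dist_norm norm_minus_commute)
        finally show ?case by simp
      qed
    qed (use int that in auto)
    also have "\<dots> = (M / d) * dist z y" by (simp add: M_def)
    finally show ?thesis by (simp add: dist_norm)
  qed
  have "M / d \<ge> 0" using dR by (simp add: M_def)
  then have "(M / d)-lipschitz_on K (log_potential \<sigma>)" using lip by (intro lipschitz_onI) auto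
  then show ?thesis by (rule lipschitz_on_continuous_on)
qed

text \<open>Cut \<open>P\<close> into finitely many Borel pieces of radius at most \<open>\<epsilon> d\<close>, where \<open>d\<close> is the distance of
\<open>K\<close> and \<open>P\<close>, and move the mass of each piece to a point of \<open>P\<close>. On the relevant range the
logarithm is Lipschitz with constant \<open>1 / d\<close>.\<close>

lemma log_potential_discretization:
  assumes K: "compact K" and P: "compact P" and disj: "K \<inter> P = {}" and \<sigma>: "\<sigma> \<in> positive_measures P"
    and "\<epsilon> > 0"
  obtains n and \<zeta> :: "nat \<Rightarrow> complex" and m :: "nat \<Rightarrow> real"
  where "\<And>i. i < n \<Longrightarrow> \<zeta> i \<in> P" "\<And>i. m i \<ge> 0" "(\<Sum>i<n. m i) \<le> measure \<sigma> UNIV"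
    "\<And>z. z \<in> K \<Longrightarrow> \<bar>log_potential \<sigma> z + (\<Sum>i<n. m i * ln (cmod (z - \<zeta> i)))\<bar> \<le> \<epsilon> * measure \<sigma> UNIV"
proof -
  interpret finite_measure \<sigma> using \<sigma> by (simp add: positive_measures_def)
  have sets: "sets \<sigma> = sets borel" using \<sigma> by (simp add: positive_measures_def)
  then have space: "space \<sigma> = UNIV" using sets_eq_imp_space_eq by fastforce
  obtain d R where dR: "0 < d" "d \<le> R"
    "\<And>z \<zeta>. z \<in> K \<Longrightarrow> \<zeta> \<in> P \<Longrightarrow> d \<le> cmod (z - \<zeta>) \<and> cmod (z - \<zeta>) \<le> R"
    using disjoint_compact_distances[OF K P disj] by blast
  obtain F where F: "F \<subseteq> P" "finite F" "P \<subseteq> (\<Union>x\<in>F. ball x (\<epsilon> * d))"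
    by (rule compactE_image[OF P, of P "\<lambda>x. ball x (\<epsilon> * d)"]) (use \<open>\<epsilon> > 0\<close> dR(1) in auto)
  obtain xs where xs: "set xs = F" using finite_list[OF F(2)] by blast
  define n where "n = length xs"
  define \<zeta> where "\<zeta> = (\<lambda>i. xs ! i)"
  have \<zeta>: "\<zeta> i \<in> P" if "i < n" for i using that F(1) xs by (auto simp: \<zeta>_def n_def)
  define B where "B = disjointed (\<lambda>i. ball (\<zeta> i) (\<epsilon> * d))"
  have B_sets: "B i \<in> sets \<sigma>" for i
    unfolding sets B_def disjointed_def by (intro sets.Diff sets.finite_UN) auto
  have B_disj: "disjoint_family B" unfolding B_def by (rule disjoint_family_disjointed)
  have B_sub: "B i \<subseteq> ball (\<zeta> i) (\<epsilon> * d)" for i unfolding B_def by (rule disjointed_subset)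
  have "P \<subseteq> (\<Union>i\<in>{0..<n}. ball (\<zeta> i) (\<epsilon> * d))"
    using F(3) unfolding xs[symmetric] set_conv_nth \<zeta>_def n_def by fastforce
  then have B_cover: "P \<subseteq> (\<Union>i\<in>{0..<n}. B i)" unfolding B_def finite_UN_disjointed_eq .
  define m where "m = (\<lambda>i. measure \<sigma> (B i))"
  show ?thesis
  proof (rule that[of n \<zeta> m])
    show "\<zeta> i \<in> P" if "i < n" for i using \<zeta> that .
    show "m i \<ge> 0" for i by (simp add: m_def)
    have "(\<Sum>i<n. m i) = measure \<sigma> (\<Union>i\<in>{..<n}. B i)"
      unfolding m_def using B_sets B_disj
      by (intro finite_measure_finite_Union[symmetric]) (auto simp: disjoint_family_on_def)
    also have "\<dots> \<le> measure \<sigma> UNIV" using bounded_measure space by metis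
    finally show "(\<Sum>i<n. m i) \<le> measure \<sigma> UNIV" .
    fix z assume z: "z \<in> K"
    define f where "f = (\<lambda>\<zeta>. ln (cmod (z - \<zeta>)))"
    define g where "g = (\<lambda>x. \<Sum>i<n. indicator (B i) x * f (\<zeta> i))"
    have int_f: "integrable \<sigma> f"
      unfolding f_def by (rule ln_distance_integrable[OF \<sigma> dR(1), of z R]) (use dR(3) z in auto)
    have int_ind: "integrable \<sigma> (\<lambda>x. indicator (B i) x * f (\<zeta> i))" for i
      using B_sets by (intro integrable_mult_left integrable_real_indicator) (auto simp: emeasure_eq_measure)
    have int_g: "integrable \<sigma> g" unfolding g_def by (intro Bochner_Integration.integrable_sum int_ind)
    have g_int: "(LINT x|\<sigma>. g x) = (\<Sum>i<n. m i * f (\<zeta> i))"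
      unfolding g_def Bochner_Integration.integral_sum[OF int_ind]
      by (simp add: m_def space)
    have "\<bar>log_potential \<sigma> z + (\<Sum>i<n. m i * f (\<zeta> i))\<bar> = norm (LINT x|\<sigma>. g x - f x)"
      using int_f int_g g_int by (simp add: log_potential_def f_def)
    also have "\<dots> \<le> (LINT x|\<sigma>. norm (g x - f x))" by (rule integral_norm_bound)
    also have "\<dots> \<le> (LINT x|\<sigma>. \<epsilon>)"
    proof (rule integral_mono_AE)
      show "AE x in \<sigma>. norm (g x - f x) \<le> \<epsilon>"
        using positive_measures_AE[OF \<sigma>]
      proof eventually_elim
        case (elim x)
        then obtain i where i: "i < n" "x \<in> B i" using B_cover by auto
        have "g x = (\<Sum>j<n. if j = i then f (\<zeta> i) else 0)"
          unfolding g_def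
        proof (rule sum.cong)
          fix j assume "j \<in> {..<n}"
          have "x \<notin> B j" if "j \<noteq> i" using that i B_disj by (auto simp: disjoint_family_on_def)
          then show "indicator (B j) x * f (\<zeta> j) = (if j = i then f (\<zeta> i) else 0)" using i by auto
        qed simp
        then have "g x = f (\<zeta> i)" using i by simp
        moreover have "\<bar>f (\<zeta> i) - f x\<bar> \<le> \<bar>cmod (z - \<zeta> i) - cmod (z - x)\<bar> / d"
          unfolding f_def using dR(1) dR(3)[OF z elim] dR(3)[OF z \<zeta>[OF i(1)]]
          by (intro abs_ln_diff_le) auto
        moreover have "\<bar>cmod (z - \<zeta> i) - cmod (z - x)\<bar> \<le> dist (\<zeta> i) x"
          using norm_triangle_ineq3[of "z - \<zeta> i" "z - x"] by (simp add: dist_norm norm_minus_commute)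
        moreover have "dist (\<zeta> i) x \<le> \<epsilon> * d" using B_sub[of i] i(2) by auto
        ultimately have "\<bar>g x - f x\<bar> \<le> (\<epsilon> * d) / d"
          using dR(1) by (smt (verit) divide_right_mono)
        then show ?case using dR(1) by simp
      qed
    qed (use int_f int_g in auto)
    also have "\<dots> = \<epsilon> * measure \<sigma> UNIV" by (simp add: space)
    finally show "\<bar>log_potential \<sigma> z + (\<Sum>i<n. m i * ln (cmod (z - \<zeta> i)))\<bar> \<le> \<epsilon> * measure \<sigma> UNIV"
      by (simp add: f_def)
  qed
qed

text \<open>The \<open>k\<close>-th power of the weight is comparable with \<open>1 / |q|\<close>, where \<open>q\<close> has a zero of order
\<open>\<lfloor>k m\<^sub>i\<rfloor>\<close> at each mass point of a discretisation of \<open>\<sigma>\<close>. Rounding changes the exponent of each of the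
\<open>n\<close> factors by less than \<open>1\<close>, an error that is independent of \<open>k\<close> and hence eventually
swallowed by \<open>t\<^sup>k\<close>.\<close>

lemma potential_weight_approx:
  assumes K: "compact K" and P: "compact P" and disj: "K \<inter> P = {}" and \<sigma>: "\<sigma> \<in> positive_measures P"
    and t: "t > 1"
  shows "eventually (\<lambda>k. \<exists>q. q \<noteq> 0 \<and> degree q \<le> nat \<lceil>measure \<sigma> UNIV\<rceil> * k \<and> {z. poly q z = 0} \<subseteq> P \<and>
     (\<forall>z\<in>K. cmod (poly q z) * exp (log_potential \<sigma> z) ^ k \<le> t ^ k \<and>
            1 \<le> t ^ k * (cmod (poly q z) * exp (log_potential \<sigma> z) ^ k))) sequentially"
proof -
  define M where "M = measure \<sigma> UNIV"
  \<comment> \<open>Half of the admissible error \<open>k ln t\<close> goes to the discretisation, half to the rounding.\<close>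
  define \<epsilon> where "\<epsilon> = ln t / (2 * (M + 1))"
  have "M \<ge> 0" by (simp add: M_def)
  have "ln t > 0" using t by simp
  have \<epsilon>: "\<epsilon> > 0" "\<epsilon> * M \<le> ln t / 2"
    using \<open>ln t > 0\<close> \<open>M \<ge> 0\<close> by (auto simp: \<epsilon>_def divide_simps mult_left_mono)
  obtain d R where dR: "0 < d" "d \<le> R"
    "\<And>z \<zeta>. z \<in> K \<Longrightarrow> \<zeta> \<in> P \<Longrightarrow> d \<le> cmod (z - \<zeta>) \<and> cmod (z - \<zeta>) \<le> R"
    using disjoint_compact_distances[OF K P disj] by blast
  define L where "L = max \<bar>ln d\<bar> \<bar>ln R\<bar>"
  have L: "\<bar>ln (cmod (z - \<zeta>))\<bar> \<le> L" if "z \<in> K" "\<zeta> \<in> P" for z \<zeta>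
    unfolding L_def using abs_ln_le_max[OF dR(1)] dR(3)[OF that] by simp
  obtain n \<zeta> m where \<zeta>: "\<And>i. i < n \<Longrightarrow> \<zeta> i \<in> P" and m: "\<And>i. m i \<ge> 0" "(\<Sum>i<(n::nat). m i) \<le> M"
    and approx: "\<And>z. z \<in> K \<Longrightarrow> \<bar>log_potential \<sigma> z + (\<Sum>i<n. m i * ln (cmod (z - \<zeta> i)))\<bar> \<le> \<epsilon> * M"
    by (rule log_potential_discretization[OF K P disj \<sigma> \<epsilon>(1), folded M_def]) (rule that)
  obtain N :: nat where N: "2 * n * L / ln t \<le> N" using real_arch_simple by blast
  show ?thesis
    unfolding eventually_sequentially
  proof (intro exI[of _ N] allI impI)
    fix k assume k: "k \<ge> N"
    define a where "a = (\<lambda>i. nat \<lfloor>k * m i\<rfloor>)"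
    have a: "real (a i) \<le> k * m i" "k * m i - 1 \<le> real (a i)" for i
      using m(1)[of i] by (auto simp: a_def)
    define q where "q = (\<Prod>i<n. [:- \<zeta> i, 1:] ^ a i)"
    have "q \<noteq> 0" by (simp add: q_def)
    moreover have "degree q \<le> nat \<lceil>M\<rceil> * k"
    proof -
      have "degree q = (\<Sum>i<n. a i)"
        unfolding q_def by (subst degree_prod_eq_sum_degree) (auto simp: degree_power_eq)
      then have "real (degree q) \<le> (\<Sum>i<n. k * m i)" using a by (simp add: sum_mono)
      also have "\<dots> \<le> k * M" using m(2) by (simp add: mult_left_mono flip: sum_distrib_left)
      also have "\<dots> \<le> k * real (nat \<lceil>M\<rceil>)" by (intro mult_left_mono real_nat_ceiling_ge) auto
      finally show ?thesis by (simp flip: of_nat_mult add: mult.commute)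
    qed
    moreover have "{z. poly q z = 0} \<subseteq> P"
      using \<zeta> by (auto simp: q_def poly_prod)
    moreover have "cmod (poly q z) * exp (log_potential \<sigma> z) ^ k \<le> t ^ k \<and>
            1 \<le> t ^ k * (cmod (poly q z) * exp (log_potential \<sigma> z) ^ k)" if z: "z \<in> K" for z
    proof -
      define l where "l = (\<lambda>i. ln (cmod (z - \<zeta> i)))"
      define E where "E = (\<Sum>i<n. a i * l i) + k * log_potential \<sigma> z"
      have "z \<noteq> \<zeta> i" if "i < n" for i using \<zeta>[OF that] z disj by auto
      then have "cmod (poly q z) = (\<Prod>i<n. exp (a i * l i))"
        unfolding q_def poly_prod prod_norm[symmetric]
        by (intro prod.cong) (auto simp: l_def norm_power exp_of_nat_mult)
      then have eq: "cmod (poly q z) * exp (log_potential \<sigma> z) ^ k = exp E"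
        by (simp add: exp_sum exp_add E_def exp_of_nat_mult)
      have "E = (\<Sum>i<n. (a i - k * m i) * l i) + k * (log_potential \<sigma> z + (\<Sum>i<n. m i * l i))"
        by (simp add: E_def algebra_simps sum_subtractf sum_distrib_left)
      also have "\<bar>\<dots>\<bar> \<le> \<bar>\<Sum>i<n. (a i - k * m i) * l i\<bar> + \<bar>k * (log_potential \<sigma> z + (\<Sum>i<n. m i * l i))\<bar>"
        by (rule abs_triangle_ineq)
      also have "\<bar>\<Sum>i<n. (a i - k * m i) * l i\<bar> \<le> (\<Sum>i<n. L)"
      proof (rule order_trans[OF sum_abs sum_mono])
        fix i assume i: "i \<in> {..<n}"
        have "\<bar>a i - k * m i\<bar> \<le> 1" using a[of i] by linarith
        then have "\<bar>a i - k * m i\<bar> * \<bar>l i\<bar> \<le> 1 * L"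
          using L[OF z \<zeta>] i by (intro mult_mono) (auto simp: l_def)
        then show "\<bar>(a i - k * m i) * l i\<bar> \<le> L" by (simp add: abs_mult)
      qed
      also have "\<bar>k * (log_potential \<sigma> z + (\<Sum>i<n. m i * l i))\<bar> \<le> k * (\<epsilon> * M)"
        using approx[OF z] by (simp add: abs_mult l_def mult_left_mono)
      also have "\<dots> \<le> k * (ln t / 2)" using \<epsilon>(2) by (intro mult_left_mono) auto
      also have "(\<Sum>i<n. L) \<le> k * (ln t / 2)"
      proof -
        have "2 * n * L / ln t \<le> k" using N k by linarith
        then show ?thesis using \<open>ln t > 0\<close> by (simp add: divide_simps mult_ac split: if_splits)
      qed
      finally have "\<bar>E\<bar> \<le> k * ln t" by simp
      then have "exp E \<le> exp (k * ln t)" "1 \<le> exp (k * ln t) * exp E"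
        unfolding exp_add[symmetric] by (auto simp: abs_le_iff)
      moreover have "exp (k * ln t) = t ^ k" using t by (simp add: exp_of_nat_mult)
      ultimately show ?thesis unfolding eq by simp
    qed
    ultimately show "\<exists>q. q \<noteq> 0 \<and> degree q \<le> nat \<lceil>measure \<sigma> UNIV\<rceil> * k \<and> {z. poly q z = 0} \<subseteq> P \<and>
     (\<forall>z\<in>K. cmod (poly q z) * exp (log_potential \<sigma> z) ^ k \<le> t ^ k \<and>
            1 \<le> t ^ k * (cmod (poly q z) * exp (log_potential \<sigma> z) ^ k))"
      unfolding M_def by blast
  qed
qed

section \<open>The weighted and the rational Bernstein Markov property\<close>

theorem theorem2p3:
  fixes K P :: "complex set" and \<mu> :: "complex measure"
  assumes "compact K" and "\<not> polar K"
    and "\<mu> \<in> positive_measures K" and "measure_support \<mu> = K"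
    and "Bernstein_Markov K \<mu>"
    and "compact P" and "K \<inter> P = {}"
    and "is_shilov_boundary K K \<or> polynomial_hull K \<inter> P = {}"
  shows "(\<forall>w\<in>potential_weights P. weighted_Bernstein_Markov K \<mu> w)
         \<and> rational_Bernstein_Markov K \<mu> P"
proof -
  note K = \<open>compact K\<close> and P = \<open>compact P\<close> and disj = \<open>K \<inter> P = {}\<close>
    and \<mu> = \<open>\<mu> \<in> positive_measures K\<close> and BM = \<open>Bernstein_Markov K \<mu>\<close>
  have absorbed: "poles_absorbed K P"
    using assms(8) poles_absorbed_outer_boundary[OF K P disj shilov_imp_outer_boundary[OF K]]
      poles_absorbed_off_hull[OF K P disj] by blast
  have nonempty: "K \<noteq> {}" if "nonvanishing_seq K g" for g
    using that by (auto simp: nonvanishing_seq_def)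
  have "weighted_Bernstein_Markov K \<mu> w" if "w \<in> potential_weights P" for w
  proof -
    obtain \<sigma> where \<sigma>: "\<sigma> \<in> positive_measures P" and w: "w = (\<lambda>z. exp (log_potential \<sigma> z))"
      using \<open>w \<in> potential_weights P\<close> by (auto simp: potential_weights_def)
    have cont: "continuous_on K w"
      unfolding w by (intro continuous_intros log_potential_continuous_on[OF K P disj \<sigma>])
    show ?thesis
      unfolding weighted_Bernstein_Markov_def
    proof (intro conjI allI impI)
      have "openin (top_of_set K) (K \<inter> w -` {..<c})" for c
        using cont by (rule continuous_openin_preimage_gen) simp
      moreover have "K \<inter> w -` {..<c} = {z\<in>K. w z < c}" for c by auto
      ultimately show "weight_on K w" unfolding weight_on_def by (simp add: w)
    next
      fix p :: "nat \<Rightarrow> complex poly"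
      assume p: "(\<forall>k. degree (p k) \<le> k) \<and> nonvanishing_seq K (\<lambda>k z. poly (p k) z * of_real (w z ^ k))"
      then have K0: "K \<noteq> {}" using nonempty by blast
      show "limsup_norm_ratio_le_1 K \<mu> (\<lambda>k z. poly (p k) z * of_real (w z ^ k))"
      proof (rule limsup_norm_ratio_le_1I)
        fix t :: real assume t: "t > 1"
        \<comment> \<open>One factor \<open>s\<close> for passing from \<open>p w\<^sup>k\<close> to \<open>p / q\<close>, one for the norm comparison, one for the way back.\<close>
        define s where "s = root 3 t"
        have s: "s > 1" "s ^ 3 = t" using t by (auto simp: s_def)
        show "eventually (\<lambda>k. sup_norm K (\<lambda>z. poly (p k) z * of_real (w z ^ k))
            \<le> t ^ k * L2_norm_on K \<mu> (\<lambda>z. poly (p k) z * of_real (w z ^ k))) sequentially"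
          using potential_weight_approx[OF K P disj \<sigma> s(1)]
            rational_norm_comparison[OF K K0 \<mu> BM disj absorbed s(1), of "nat \<lceil>measure \<sigma> UNIV\<rceil>"]
        proof eventually_elim
          case (elim k)
          obtain q where q: "q \<noteq> 0" "degree q \<le> nat \<lceil>measure \<sigma> UNIV\<rceil> * k" "{z. poly q z = 0} \<subseteq> P"
            and upper: "\<And>z. z \<in> K \<Longrightarrow> cmod (poly q z) * w z ^ k \<le> s ^ k"
            and lower: "\<And>z. z \<in> K \<Longrightarrow> 1 \<le> s ^ k * (cmod (poly q z) * w z ^ k)"
            using elim(1) unfolding w by blast
          define r where "r = (\<lambda>z. poly (p k) z / poly q z)"
          define g where "g = (\<lambda>z. poly (p k) z * complex_of_real (w z ^ k))"
          have q0: "poly q z \<noteq> 0" if "z \<in> K" for z using that q(3) disj by auto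
          have contr: "continuous_on K r"
            unfolding r_def using q0 by (intro continuous_intros) auto
          have contg: "continuous_on K g"
            unfolding g_def by (intro continuous_intros cont)
          have rg: "cmod (g z) = cmod (r z) * (cmod (poly q z) * w z ^ k)" if "z \<in> K" for z
            using q0[OF that] by (simp add: g_def r_def norm_mult norm_divide norm_power w)
          have "sup_norm K r \<le> s ^ k * L2_norm_on K \<mu> r"
            using elim(2) p q unfolding r_def by blast
          also have "L2_norm_on K \<mu> r \<le> s ^ k * L2_norm_on K \<mu> g"
          proof (rule L2_norm_on_le_scaled[OF K \<mu> contr contg])
            show "s ^ k \<ge> 0" using s by simp
            show "cmod (r z) \<le> s ^ k * cmod (g z)" if "z \<in> K" for z
              using mult_left_mono[OF lower[OF that] norm_ge_zero[of "r z"]] rg[OF that] by (simp add: mult_ac)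
          qed
          finally have r_le: "sup_norm K r \<le> s ^ k * (s ^ k * L2_norm_on K \<mu> g)"
            using s by (simp add: mult_left_mono)
          have "sup_norm K g \<le> t ^ k * L2_norm_on K \<mu> g"
          proof (rule sup_norm_le[OF K0])
            fix z assume z: "z \<in> K"
            have "cmod (g z) \<le> cmod (r z) * s ^ k"
              unfolding rg[OF z] by (intro mult_left_mono upper z) auto
            also have "\<dots> \<le> sup_norm K r * s ^ k"
              using s by (intro mult_right_mono le_sup_norm K contr z) auto
            also have "\<dots> \<le> s ^ k * (s ^ k * L2_norm_on K \<mu> g) * s ^ k"
              using s by (intro mult_right_mono r_le) auto
            also have "\<dots> = t ^ k * L2_norm_on K \<mu> g"
              by (simp add: s(2)[symmetric] power3_eq_cube power_mult_distrib)
            finally show "cmod (g z) \<le> t ^ k * L2_norm_on K \<mu> g" .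
          qed
          then show ?case by (simp add: g_def)
        qed
      qed
    qed
  qed
  moreover have "rational_Bernstein_Markov K \<mu> P"
    unfolding rational_Bernstein_Markov_def
  proof (intro allI impI)
    fix p q :: "nat \<Rightarrow> complex poly"
    assume pq: "(\<forall>k. degree (p k) \<le> k \<and> degree (q k) \<le> k \<and> {z. poly (q k) z = 0} \<subseteq> P) \<and>
        nonvanishing_seq K (\<lambda>k z. poly (p k) z / poly (q k) z)"
    then have K0: "K \<noteq> {}" using nonempty by blast
    have q0: "q k \<noteq> 0" for k
    proof
      assume "q k = 0"
      then have "P = UNIV" using pq by (auto dest!: spec[of _ k])
      then show False using disj K0 by simp
    qed
    show "limsup_norm_ratio_le_1 K \<mu> (\<lambda>k z. poly (p k) z / poly (q k) z)"
    proof (rule limsup_norm_ratio_le_1I)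
      fix t :: real assume t: "t > 1"
      from rational_norm_comparison[OF K K0 \<mu> BM disj absorbed t, of 1]
      show "eventually (\<lambda>k. sup_norm K (\<lambda>z. poly (p k) z / poly (q k) z)
          \<le> t ^ k * L2_norm_on K \<mu> (\<lambda>z. poly (p k) z / poly (q k) z)) sequentially"
        by eventually_elim (use pq q0 in simp)
    qed
  qed
  ultimately show ?thesis by blast
qed

end
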